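(* Let $\mathbb F$ be an algebraically closed field and let $q\in\mathbb F$ be nonzero and not a root of unity. Let $V$ denote an evaluation module for $\boxtimes_q$ that has diameter $d$. Then there exists a unique $t\in\mathbb F$ such that: (i) $t$ is nonzero and not among $\{q^{d-2n+1}\}_{n=1}^d$; (ii) the $\boxtimes_q$-module $V$ is isomorphic to $\mathbf V_d(t)$.
   Context: Algebras are associative with 1. $[n]_q=(q^n-q^{-n})/(q-q^{-1})$ and $\mathbb Z_4=\mathbb Z/4\mathbb Z$. The $q$-tetrahedron algebra $\boxtimes_q$ is the $\mathbb F$-algebra with generators (called the standard generators) $\{x_{ij}\mid i,j\in\mathbb Z_4,\ j-i=1\text{ or }j-i=2\}$ and relations: (i) $x_{ij}x_{ji}=1$ if $j-i=2$; (ii) $\frac{qx_{ij}x_{jk}-q^{-1}x_{jk}x_{ij}}{q-q^{-1}}=1$ if $(j-i,k-j)$ is one of $(1,1),(1,2),(2,1)$; (iii) $x_{ij}^3x_{k\ell}-[3]_qx_{ij}^2x_{k\ell}x_{ij}+[3]_qx_{ij}x_{k\ell}x_{ij}^2-x_{k\ell}x_{ij}^3=0$ if $j-i=k-j=\ell-k=1$. Known fact: on a finite-dimensional irreducible $\boxtimes_q$-module $V$ there are $d\in\mathbb N$ (the diameter) and $\varepsilon\in\{1,-1\}$ (the type) such that each standard generator is diagonalizable with set of distinct eigenvalues $\{\varepsilon q^{d-2n}\mid 0\le n\le d\}$. If $V$ has type 1, the sequence of dimensions of the eigenspaces of $x_{ij}$ for eigenvalues $q^{d},q^{d-2},\dots,q^{-d}$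 does not depend on $x_{ij}$; it is called the shape of $V$. The trivial $\boxtimes_q$-module is the one-dimensional module on which every standard generator acts as the identity. An evaluation module for $\boxtimes_q$ is a nontrivial finite-dimensional irreducible $\boxtimes_q$-module of type 1 and shape $(1,1,\dots,1)$ (so $d\ge1$ and $\dim V=d+1$). Matrices in ${\rm Mat}_{d+1}(\mathbb F)$ have rows and columns indexed by $0,\dots,d$; $M$ represents $A$ with respect to a basis $\{v_n\}_{n=0}^d$ when $Av_n=\sum_i M_{in}v_i$. Entries not mentioned below are $0$. A subscript $q^{-1}$ means that $q$ is replaced by $q^{-1}$ in the definition (and similarly $t^{-1}$ as argument). - $Z$: $(i,j)$-entry $\delta_{i+j,d}$. - $K_q$: diagonal, $(i,i)$-entry $q^{d-2i}$. - $E_q$: $(i,i)$-entry $q^{2i-d}$; $(i-1,i)$-entry $q^d-q^{2i-2-d}$. - $G_q(t)$: $(i,i)$-entry $q^{2i-d}$; $(i-1,i)$-entry $(q^d-q^{2i-2-d})(1-tq^{d-2i+1})$. - $L_q(t)$: $(i,i)$-entry $q^{2i-d}$; $(i-1,i)$-entry $(q^d-q^{2i-2-d})(1-tq^{d-2i+1})^{-1}$. - $S_q(t)$: $(i-1,i)$-entry $(q^d-q^{2i-d-2})(1-tq^{2i-d-1})$; $(i,i-1)$-entry $(q^{2i-d}-q^{-d})q^{2i-d-1}t$; $(i,i)$-entry $q^d-(q^{2i-d}-q^{-d})q^{2i-d-1}t-(q^d-q^{2i-d})(1-tq^{2i-d+1})$. For an integer $d\ge1$ and a nonzero $t\in\mathbb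 F$ not among $\{q^{d-2n+1}\}_{n=1}^d$, $\mathbf V_d(t)$ is the evaluation module for $\boxtimes_q$ having a basis with respect to which the standard generators are represented by: $x_{01}: ZS_{q^{-1}}(t^{-1})Z$, $x_{12}: E_q$, $x_{23}: K_q$, $x_{30}: ZG_{q^{-1}}(t)Z$, $x_{02}: L_q(t)$, $x_{13}: (ZE_{q^{-1}}Z)^{-1}$, $x_{20}: (L_q(t))^{-1}$, $x_{31}: ZE_{q^{-1}}Z$. *)

theory Defs
  imports
    "HOL-Library.Poly_Mapping"
    "HOL-Library.Numeral_Type"
    "HOL-Library.Function_Algebras"
    "HOL-Algebra.QuotRing"
    "HOL-Computational_Algebra.Polynomial"
    "Jordan_Normal_Form.Matrix"
begin

section \<open>The free algebra on the standard generators\<close>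

text \<open>The numeral type \<open>4\<close> is the ring of integers modulo 4.\<close>

typedef std_gen = "{(i :: 4, j :: 4). j - i = 1 \<or> j - i = 2}"
  by (rule exI[of _ "(0, 1)"]) simp

datatype gen_word = Word "std_gen list"

instantiation gen_word :: monoid_add
begin

definition zero_gen_word :: gen_word where
  "0 = Word []"

fun plus_gen_word :: "gen_word \<Rightarrow> gen_word \<Rightarrow> gen_word" where
  "Word u + Word v = Word (u @ v)"

instance
proof
  fix a b c :: gen_word
  show "a + b + c = a + (b + c)" by (cases a; cases b; cases c) simp
  show "0 + a = a" by (cases a) (simp add: zero_gen_word_def)
  show "a + 0 = a" by (cases a) (simp add: zero_gen_word_def)
qed

end

text \<open>Words form the free monoid, written additively, so the convolution product of
  \<open>poly_mapping\<close> makes this type the free unital associative algebra over \<open>'f\<close>.\<close>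

type_synonym 'f free_alg = "(gen_word, 'f) poly_mapping"

definition fa_const :: "'f::field \<Rightarrow> 'f free_alg" where
  "fa_const c = Poly_Mapping.single 0 c"

definition fa_var :: "4 \<Rightarrow> 4 \<Rightarrow> 'f::field free_alg" where
  "fa_var i j = Poly_Mapping.single (Word [Abs_std_gen (i, j)]) 1"

definition free_ring :: "'f::field free_alg ring" where
  "free_ring = \<lparr>carrier = UNIV, monoid.mult = (*), one = 1, zero = 0, add = (+)\<rparr>"


section \<open>The $q$-tetrahedron algebra\<close>

definition qnum :: "'f::field \<Rightarrow> nat \<Rightarrow> 'f" where
  "qnum q n = (q powi int n - q powi (- int n)) / (q - inverse q)"

inductive_set relators :: "'f::field \<Rightarrow> 'f free_alg set" for q :: 'f where
  inv: "j - i = 2 \<Longrightarrow> fa_var i j * fa_var j i - 1 \<in> relators q"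
| weyl: "(j - i, k - j) \<in> {(1, 1), (1, 2), (2, 1)} \<Longrightarrow>
    fa_const (1 / (q - inverse q)) *
      (fa_const q * fa_var i j * fa_var j k - fa_const (inverse q) * fa_var j k * fa_var i j) - 1 \<in> relators q"
| serre: "j - i = 1 \<Longrightarrow> k - j = 1 \<Longrightarrow> l - k = 1 \<Longrightarrow>
    fa_var i j ^ 3 * fa_var k l
      - fa_const (qnum q 3) * fa_var i j ^ 2 * fa_var k l * fa_var i j
      + fa_const (qnum q 3) * fa_var i j * fa_var k l * fa_var i j ^ 2
      - fa_var k l * fa_var i j ^ 3 \<in> relators q"

text \<open>HOL-Algebra ideals are two-sided, so \<open>genideal\<close> is the two-sided ideal generated by the relators.\<close>

definition relator_ideal :: "'f::field \<Rightarrow> 'f free_alg set" where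
  "relator_ideal q = genideal free_ring (relators q)"

definition boxtimes :: "'f::field \<Rightarrow> 'f free_alg set ring" where
  "boxtimes q = free_ring Quot relator_ideal q"

definition box_proj :: "'f::field \<Rightarrow> 'f free_alg \<Rightarrow> 'f free_alg set" where
  "box_proj q p = a_r_coset free_ring (relator_ideal q) p"

definition xgen :: "'f::field \<Rightarrow> 4 \<Rightarrow> 4 \<Rightarrow> 'f free_alg set" where
  "xgen q i j = box_proj q (fa_var i j)"

definition std_gens :: "'f::field \<Rightarrow> 'f free_alg set set" where
  "std_gens q = {xgen q i j |i j. j - i = 1 \<or> j - i = 2}"


section \<open>Modules\<close>

text \<open>A module is carried by a subspace \<open>mod_space V\<close> of an ambient vector space (addition is that
  of the type \<open>'v\<close>, scalar multiplication is \<open>mod_scale V\<close>); elements \<open>a\<close> of the algebra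
  act by \<open>mod_act V a\<close>, which is only relevant on \<open>mod_space V\<close>.\<close>

record (overloaded) ('f, 'v) qmod =
  mod_space :: "'v set"
  mod_scale :: "'f \<Rightarrow> 'v \<Rightarrow> 'v"
  mod_act :: "'f free_alg set \<Rightarrow> 'v \<Rightarrow> 'v"

definition boxtimes_module :: "'f::field \<Rightarrow> ('f, 'v::ab_group_add) qmod \<Rightarrow> bool" where
  "boxtimes_module q V \<longleftrightarrow>
    vector_space (mod_scale V) \<and>
    module.subspace (mod_scale V) (mod_space V) \<and>
    (\<forall>a \<in> carrier (boxtimes q). \<forall>v \<in> mod_space V. mod_act V a v \<in> mod_space V) \<and>
    (\<forall>a \<in> carrier (boxtimes q). \<forall>v \<in> mod_space V. \<forall>w \<in> mod_space V.
        mod_act V a (v + w) = mod_act V a v + mod_act V a w) \<and>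
    (\<forall>a \<in> carrier (boxtimes q). \<forall>b \<in> carrier (boxtimes q). \<forall>v \<in> mod_space V.
        mod_act V (a \<oplus>\<^bsub>boxtimes q\<^esub> b) v = mod_act V a v + mod_act V b v) \<and>
    (\<forall>a \<in> carrier (boxtimes q). \<forall>b \<in> carrier (boxtimes q). \<forall>v \<in> mod_space V.
        mod_act V (a \<otimes>\<^bsub>boxtimes q\<^esub> b) v = mod_act V a (mod_act V b v)) \<and>
    (\<forall>v \<in> mod_space V. mod_act V \<one>\<^bsub>boxtimes q\<^esub> v = v) \<and>
    (\<forall>c. \<forall>v \<in> mod_space V. mod_act V (box_proj q (fa_const c)) v = mod_scale V c v)"

definition finite_dim :: "('f::field, 'v::ab_group_add) qmod \<Rightarrow> bool" where
  "finite_dim V \<longleftrightarrow> (\<exists>B. finite B \<and> B \<subseteq> mod_space V \<and> module.span (mod_scale V) B = mod_space V)"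

definition submodule :: "'f::field \<Rightarrow> 'v set \<Rightarrow> ('f, 'v::ab_group_add) qmod \<Rightarrow> bool" where
  "submodule q W V \<longleftrightarrow> W \<subseteq> mod_space V \<and> module.subspace (mod_scale V) W \<and>
    (\<forall>a \<in> carrier (boxtimes q). \<forall>w \<in> W. mod_act V a w \<in> W)"

definition irreducible_module :: "'f::field \<Rightarrow> ('f, 'v::ab_group_add) qmod \<Rightarrow> bool" where
  "irreducible_module q V \<longleftrightarrow> boxtimes_module q V \<and> mod_space V \<noteq> {0} \<and>
    (\<forall>W. submodule q W V \<longrightarrow> W = {0} \<or> W = mod_space V)"

text \<open>Linearity over \<open>'f\<close> is implied, as scalars act through elements of the algebra.\<close>

definition isomorphic_modules ::
  "'f::field \<Rightarrow> ('f, 'v::ab_group_add) qmod \<Rightarrow> ('f, 'w::ab_group_add) qmod \<Rightarrow> bool" where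
  "isomorphic_modules q V W \<longleftrightarrow> boxtimes_module q V \<and> boxtimes_module q W \<and>
    (\<exists>\<phi>. bij_betw \<phi> (mod_space V) (mod_space W) \<and>
      (\<forall>v \<in> mod_space V. \<forall>w \<in> mod_space V. \<phi> (v + w) = \<phi> v + \<phi> w) \<and>
      (\<forall>a \<in> carrier (boxtimes q). \<forall>v \<in> mod_space V. \<phi> (mod_act V a v) = mod_act W a (\<phi> v)))"

definition eigenspace ::
  "('f::field, 'v::ab_group_add) qmod \<Rightarrow> 'f free_alg set \<Rightarrow> 'f \<Rightarrow> 'v set" where
  "eigenspace V a c = {v \<in> mod_space V. mod_act V a v = mod_scale V c v}"

definition eigenvalues ::
  "('f::field, 'v::ab_group_add) qmod \<Rightarrow> 'f free_alg set \<Rightarrow> 'f set" where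
  "eigenvalues V a = {c. eigenspace V a c \<noteq> {0}}"

definition diagonalizable ::
  "('f::field, 'v::ab_group_add) qmod \<Rightarrow> 'f free_alg set \<Rightarrow> bool" where
  "diagonalizable V a \<longleftrightarrow> module.span (mod_scale V) (\<Union>c. eigenspace V a c) = mod_space V"

definition has_diameter_type ::
  "'f::field \<Rightarrow> ('f, 'v::ab_group_add) qmod \<Rightarrow> nat \<Rightarrow> 'f \<Rightarrow> bool" where
  "has_diameter_type q V d \<epsilon> \<longleftrightarrow> \<epsilon> \<in> {1, - 1} \<and>
    (\<forall>a \<in> std_gens q. diagonalizable V a \<and>
      eigenvalues V a = {\<epsilon> * q powi (int d - 2 * int n) |n. n \<le> d})"

definition has_diameter :: "'f::field \<Rightarrow> ('f, 'v::ab_group_add) qmod \<Rightarrow> nat \<Rightarrow> bool" where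
  "has_diameter q V d \<longleftrightarrow> (\<exists>\<epsilon>. has_diameter_type q V d \<epsilon>)"

definition has_type :: "'f::field \<Rightarrow> ('f, 'v::ab_group_add) qmod \<Rightarrow> 'f \<Rightarrow> bool" where
  "has_type q V \<epsilon> \<longleftrightarrow> (\<exists>d. has_diameter_type q V d \<epsilon>)"

definition has_shape :: "'f::field \<Rightarrow> ('f, 'v::ab_group_add) qmod \<Rightarrow> nat list \<Rightarrow> bool" where
  "has_shape q V \<rho> \<longleftrightarrow> (\<exists>d. has_diameter_type q V d 1 \<and> length \<rho> = d + 1 \<and>
    (\<forall>a \<in> std_gens q. \<forall>n \<le> d.
      vector_space.dim (mod_scale V) (eigenspace V a (q powi (int d - 2 * int n))) = \<rho> ! n))"

definition trivial_module :: "'f::field \<Rightarrow> ('f, 'v::ab_group_add) qmod \<Rightarrow> bool" where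
  "trivial_module q V \<longleftrightarrow> boxtimes_module q V \<and> vector_space.dim (mod_scale V) (mod_space V) = 1 \<and>
    (\<forall>a \<in> std_gens q. \<forall>v \<in> mod_space V. mod_act V a v = v)"

definition evaluation_module :: "'f::field \<Rightarrow> ('f, 'v::ab_group_add) qmod \<Rightarrow> bool" where
  "evaluation_module q V \<longleftrightarrow> finite_dim V \<and> irreducible_module q V \<and> \<not> trivial_module q V \<and>
    has_type q V 1 \<and> (\<exists>m. has_shape q V (replicate m 1))"


section \<open>The modules $\mathbf V_d(t)$\<close>

text \<open>In entry \<open>(r, c)\<close>, the superdiagonal \<open>c = r + 1\<close> is position \<open>(i-1, i)\<close> with \<open>i = c\<close>, and
  the subdiagonal \<open>r = c + 1\<close> is position \<open>(i, i-1)\<close> with \<open>i = r\<close>.\<close>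

definition matZ :: "nat \<Rightarrow> 'f::field mat" where
  "matZ d = mat (d + 1) (d + 1) (\<lambda>(r, c). if r + c = d then 1 else 0)"

definition matK :: "nat \<Rightarrow> 'f::field \<Rightarrow> 'f mat" where
  "matK d q = mat (d + 1) (d + 1) (\<lambda>(r, c). if r = c then q powi (int d - 2 * int r) else 0)"

definition matE :: "nat \<Rightarrow> 'f::field \<Rightarrow> 'f mat" where
  "matE d q = mat (d + 1) (d + 1) (\<lambda>(r, c).
    if r = c then q powi (2 * int r - int d)
    else if c = r + 1 then q powi int d - q powi (2 * int c - 2 - int d)
    else 0)"

definition matG :: "nat \<Rightarrow> 'f::field \<Rightarrow> 'f \<Rightarrow> 'f mat" where
  "matG d q t = mat (d + 1) (d + 1) (\<lambda>(r, c).
    if r = c then q powi (2 * int r - int d)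
    else if c = r + 1 then
      (q powi int d - q powi (2 * int c - 2 - int d)) * (1 - t * q powi (int d - 2 * int c + 1))
    else 0)"

definition matL :: "nat \<Rightarrow> 'f::field \<Rightarrow> 'f \<Rightarrow> 'f mat" where
  "matL d q t = mat (d + 1) (d + 1) (\<lambda>(r, c).
    if r = c then q powi (2 * int r - int d)
    else if c = r + 1 then
      (q powi int d - q powi (2 * int c - 2 - int d))
        * inverse (1 - t * q powi (int d - 2 * int c + 1))
    else 0)"

definition matS :: "nat \<Rightarrow> 'f::field \<Rightarrow> 'f \<Rightarrow> 'f mat" where
  "matS d q t = mat (d + 1) (d + 1) (\<lambda>(r, c).
    if c = r + 1 then
      (q powi int d - q powi (2 * int c - int d - 2)) * (1 - t * q powi (2 * int c - int d - 1))
    else if r = c + 1 then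
      (q powi (2 * int r - int d) - q powi (- int d)) * q powi (2 * int r - int d - 1) * t
    else if r = c then
      q powi int d
      - (q powi (2 * int r - int d) - q powi (- int d)) * q powi (2 * int r - int d - 1) * t
      - (q powi int d - q powi (2 * int r - int d)) * (1 - t * q powi (2 * int r - int d + 1))
    else 0)"

text \<open>The two-sided inverse; only used for invertible matrices.\<close>

definition mat_inv :: "'f::field mat \<Rightarrow> 'f mat" where
  "mat_inv A = (THE B. inverts_mat A B \<and> inverts_mat B A)"

definition gen_mat :: "nat \<Rightarrow> 'f::field \<Rightarrow> 'f \<Rightarrow> 4 \<Rightarrow> 4 \<Rightarrow> 'f mat" where
  "gen_mat d q t i j =
    (if (i, j) = (0, 1) then matZ d * matS d (inverse q) (inverse t) * matZ d
     else if (i, j) = (1, 2) then matE d q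
     else if (i, j) = (2, 3) then matK d q
     else if (i, j) = (3, 0) then matZ d * matG d (inverse q) t * matZ d
     else if (i, j) = (0, 2) then matL d q t
     else if (i, j) = (1, 3) then mat_inv (matZ d * matE d (inverse q) * matZ d)
     else if (i, j) = (2, 0) then mat_inv (matL d q t)
     else matZ d * matE d (inverse q) * matZ d)"

text \<open>Column vectors of length \<open>d + 1\<close> are the functions \<open>nat \<Rightarrow> 'f\<close> vanishing beyond \<open>d\<close>. The
  basis is that of the unit vectors, so column \<open>n\<close> of a matrix is the image of the \<open>n\<close>-th one.\<close>

definition fun_scale :: "'f::field \<Rightarrow> (nat \<Rightarrow> 'f) \<Rightarrow> nat \<Rightarrow> 'f" where
  "fun_scale c v = (\<lambda>i. c * v i)"

definition mat_op :: "nat \<Rightarrow> 'f::field mat \<Rightarrow> (nat \<Rightarrow> 'f) \<Rightarrow> nat \<Rightarrow> 'f" where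
  "mat_op d A v = (\<lambda>i. if i \<le> d then \<Sum>n\<le>d. A $$ (i, n) * v n else 0)"

fun word_op :: "nat \<Rightarrow> 'f::field \<Rightarrow> 'f \<Rightarrow> gen_word \<Rightarrow> (nat \<Rightarrow> 'f) \<Rightarrow> nat \<Rightarrow> 'f" where
  "word_op d q t (Word gs) v =
    foldr (\<lambda>g. case Rep_std_gen g of (i, j) \<Rightarrow> mat_op d (gen_mat d q t i j)) gs v"

definition free_op :: "nat \<Rightarrow> 'f::field \<Rightarrow> 'f \<Rightarrow> 'f free_alg \<Rightarrow> (nat \<Rightarrow> 'f) \<Rightarrow> nat \<Rightarrow> 'f" where
  "free_op d q t p v =
    (\<Sum>w \<in> Poly_Mapping.keys p. fun_scale (Poly_Mapping.lookup p w) (word_op d q t w v))"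

text \<open>An element of the quotient acts through a representative. When \<open>t\<close> is nonzero and not among
  \<open>q^(d-2n+1)\<close> for \<open>1 \<le> n \<le> d\<close>, the choice is immaterial, as the matrices satisfy the relations.\<close>

definition Vd :: "'f::field \<Rightarrow> nat \<Rightarrow> 'f \<Rightarrow> ('f, nat \<Rightarrow> 'f) qmod" where
  "Vd q d t =
    \<lparr>mod_space = {v. \<forall>i > d. v i = 0},
     mod_scale = fun_scale,
     mod_act = (\<lambda>a. free_op d q t (SOME p. p \<in> a))\<rparr>"

end

theory Submission
  imports Defs "Jordan_Normal_Form.Determinant"
begin

text \<open>
  Let \<open>V\<close> be an evaluation module. Its generator $x_{23}$ is diagonalizable with one-dimensional
  eigenspaces for $q^d, q^{d-2}, \ldots, q^{-d}$, and all the operators are studied in an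
  eigenbasis of $x_{23}$. The relation
  $q x y - q^{-1} y x = q - q^{-1}$ between a generator and $x_{23}$ decouples into scalar equations for
  the matrix entries (\<open>weyl_upper_on\<close>, \<open>weyl_lower_on\<close>): $x_{12}$ and $x_{02}$ are upper bidiagonal,
  $x_{30}$ and $x_{31}$ are lower bidiagonal, and the diagonals are known. The same relation for the
  pairs $x_{31}, x_{12}$ and $x_{30}, x_{02}$ determines the products of opposite off-diagonal entries,
  and they are nonzero (\<open>lower_upper_product\<close>). Hence the basis can be rescaled so that $x_{12}$ is the
  matrix $E_q$, and then $x_{31}$ is determined. The remaining unknown is the superdiagonal of $x_{02}$.
  Its relation with $x_{12}$ is a first order recursion for the ratios of the two superdiagonals, with
  general solution $1 - t q^{d-2i+1}$ in column $i$; this is where \<open>t\<close> comes from. It avoids the excluded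
  powers because the ratios are nonzero, and it is nonzero because otherwise $x_{02} = x_{12}$ would
  force $x_{02}^2 = 1$. Then $x_{30}$, $x_{20}$ and $x_{13}$ are determined, and $x_{01}$ is the only
  solution of its relations with $x_{12}$ and $x_{20}$ (\<open>coord_rep_01_unique\<close>). This gives
  \<open>coord_rep.classification\<close>, the core of the existence of \<open>t\<close>.

  Uniqueness of \<open>t\<close> amounts to the statement that isomorphic modules $\mathbf V_d(t)$ have equal
  parameters, and it can be seen on two basis vectors (\<open>isomorphic_Vd_parameter\<close>).

  Both parts use that the matrices defining $\mathbf V_d(t)$ satisfy the relations of the
  $q$-tetrahedron algebra: it is what makes \<open>Vd\<close> independent of the choice of
  representatives, and it supplies a known solution with which $x_{01}$ is compared. Multiplying out the
  matrices is avoided. With $E, K, F, L$ for $x_{12}, x_{23}, x_{31}, x_{02}$ one has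
  $E = L - tq(LK - 1)$, $x_{30} = F - tq(KF - 1)$ and $x_{01} = F - t^{-1}q(FE - 1)$, and from these
  formulas together with four relations between bidiagonal matrices all the others follow in
  any ring (\<open>evaluation_relations\<close>, \<open>gen_op_relations\<close>, \<open>Vd_module\<close>).
\<close>

section \<open>Consequences of the $q$-Weyl relation\<close>

text \<open>Scalars are taken to be central elements of the ring, with \<open>p\<close> the inverse of \<open>q\<close>. Every
  identity below is then an identity between noncommutative polynomials, decided by moving the
  scalars to the front and ordering the generators with the $q$-Weyl relation.\<close>

locale central_unit =
  fixes q p :: "'a::ring_1"
  assumes q_central: "q * x = x * q"
    and p_central: "p * x = x * p"
    and qp: "q * p = 1"
begin

definition weyl :: "'a \<Rightarrow> 'a \<Rightarrow> bool" where
  "weyl x y \<longleftrightarrow> q * x * y - p * y * x = q - p"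

definition serre_form :: "'a \<Rightarrow> 'a \<Rightarrow> 'a" where
  "serre_form a b = a ^ 3 * b - (q * q + 1 + p * p) * a ^ 2 * b * a
     + (q * q + 1 + p * p) * a * b * a ^ 2 - b * a ^ 3"

lemma pq: "p * q = 1"
  using qp q_central by metis

lemma qp_left: "q * (p * x) = x" and pq_left: "p * (q * x) = x"
  by (simp_all add: mult.assoc[symmetric] qp pq)

lemma weyl_left: "weyl x y \<longleftrightarrow> x * y = p * (p * (y * x)) + 1 - p * p"
proof
  assume "weyl x y"
  then have "p * (q * x * y - p * y * x) = p * (q - p)" by (simp add: weyl_def)
  then show "x * y = p * (p * (y * x)) + 1 - p * p"
    by (simp add: algebra_simps pq_left pq)
next
  assume "x * y = p * (p * (y * x)) + 1 - p * p"
  then show "weyl x y"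
    by (simp add: weyl_def mult.assoc) (simp add: algebra_simps qp qp_left)
qed

lemma weyl_right: "weyl x y \<longleftrightarrow> y * x = q * (q * (x * y)) + 1 - q * q"
proof
  assume "weyl x y"
  then have "q * (q * x * y - p * y * x) = q * (q - p)" by (simp add: weyl_def)
  then show "y * x = q * (q * (x * y)) + 1 - q * q"
    by (simp add: algebra_simps qp_left qp)
next
  assume "y * x = q * (q * (x * y)) + 1 - q * q"
  then show "weyl x y"
    by (simp add: weyl_def mult.assoc) (simp add: algebra_simps pq pq_left)
qed

lemma central_left: "x * q = q * x" "x * p = p * x" "x * (q * y) = q * (x * y)"
    "x * (p * y) = p * (x * y)"
  by (metis q_central p_central mult.assoc)+

lemma left_mult_eq: "x * y = z \<Longrightarrow> x * (y * w) = z * w" for w x y z :: 'a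
  by (simp add: mult.assoc[symmetric])

lemma scalar_left:
  fixes s :: 'a
  assumes "\<And>x. x * s = s * x"
  shows "x * s = s * x" "x * (s * y) = s * (x * y)"
proof -
  show "x * s = s * x" by (rule assms)
  have "x * s * y = s * x * y" by (simp only: assms)
  then show "x * (s * y) = s * (x * y)" by (simp only: mult.assoc)
qed

text \<open>The evaluation parameter enters the generators through shifts \<open>y - s * u\<close> and \<open>x - s * u\<close> with
  \<open>u = x * y - 1\<close>. They keep the $q$-Weyl relation with the other element, since
  \<open>q * x * u - p * u * x = 0\<close> and \<open>q * u * y - p * y * u = 0\<close>.\<close>

lemma weyl_shift_right:
  assumes s: "\<And>x. x * s = s * x" and "weyl x y"
  shows "weyl x (y - s * (x * y - 1))"
proof -
  note r = assms(2)[unfolded weyl_left]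
  show ?thesis unfolding weyl_left
    by (simp add: algebra_simps r left_mult_eq[OF r] scalar_left[OF s, of x] scalar_left[OF s, of y]
      central_left[of x] central_left[of y] central_left[of s])
qed

lemma weyl_shift_left:
  assumes s: "\<And>x. x * s = s * x" and "weyl x y"
  shows "weyl (x - s * (x * y - 1)) y"
proof -
  note r = assms(2)[unfolded weyl_left]
  show ?thesis unfolding weyl_left
    by (simp add: algebra_simps r left_mult_eq[OF r] scalar_left[OF s, of x] scalar_left[OF s, of y]
      central_left[of x] central_left[of y] central_left[of s])
qed

text \<open>Conjugating the $q$-Weyl relation by \<open>x\<close> writes \<open>x * y * x'\<close> as a combination of \<open>y\<close> and \<open>x'\<close>,
  so that both products of the shifted element with \<open>x'\<close> become linear in \<open>y\<close> and \<open>x'\<close>.\<close>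

lemma weyl_inverse_right:
  assumes s: "\<And>x. x * s = s * x" and "weyl x y" and inv: "x * x' = 1" "x' * x = 1"
  shows "weyl (x - s * (x * y - 1)) x'"
proof -
  note r = assms(2)[unfolded weyl_left]
  note i = inv left_mult_eq[OF inv(1)] left_mult_eq[OF inv(2)]
  have "x' * (y * x) = x' * (q * (q * (x * y)) + 1 - q * q)"
    using assms(2)[unfolded weyl_right] by simp
  then have k: "x' * (y * x) = q * (q * y) + x' - q * (q * x')"
    by (simp add: algebra_simps i central_left[of x'])
  show ?thesis unfolding weyl_left
    by (simp add: algebra_simps r left_mult_eq[OF r] i k qp qp_left pq pq_left scalar_left[OF s, of x] scalar_left[OF s, of y]
      scalar_left[OF s, of x'] central_left[of x] central_left[of x'] central_left[of y] central_left[of s])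
qed

lemma weyl_inverse_left:
  assumes s: "\<And>x. x * s = s * x" and "weyl y x" and inv: "x * x' = 1" "x' * x = 1"
  shows "weyl x' (x - s * (y * x - 1))"
proof -
  note r = assms(2)[unfolded weyl_right]
  note i = inv left_mult_eq[OF inv(1)] left_mult_eq[OF inv(2)]
  have "x' * (y * x) = x' * (p * (p * (x * y)) + 1 - p * p)"
    using assms(2)[unfolded weyl_left] by simp
  then have k: "x' * (y * x) = p * (p * y) + x' - p * (p * x')"
    by (simp add: algebra_simps i central_left[of x'])
  show ?thesis unfolding weyl_right
    by (simp add: algebra_simps r left_mult_eq[OF r] i k qp qp_left pq pq_left scalar_left[OF s, of x] scalar_left[OF s, of y]
      scalar_left[OF s, of x'] central_left[of x] central_left[of x'] central_left[of y] central_left[of s])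
qed

text \<open>The terms that are linear in \<open>s\<close> or in \<open>s'\<close> vanish because each shift keeps the relation with
  \<open>z\<close>. The term in \<open>s * s'\<close> contributes a multiple of \<open>1 - z\<^sup>2\<close>, and the condition \<open>s * s' = q * q\<close>
  is what makes it cancel against the term in \<open>z\<^sup>2\<close>.\<close>

lemma weyl_opposite:
  assumes s: "\<And>x. x * s = s * x" and s': "\<And>x. x * s' = s' * x" and ss: "s * s' = q * q"
    and "weyl x y" "weyl y z" "weyl z x"
  shows "weyl (z - s * (y * z - 1)) (z - s' * (z * x - 1))"
proof -
  note r = assms(4)[unfolded weyl_left] assms(5)[unfolded weyl_right] assms(6)[unfolded weyl_right]
  have ss': "s * (s' * v) = q * (q * v)" for v by (simp add: mult.assoc[symmetric] ss)
  show ?thesis unfolding weyl_left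
    by (simp add: algebra_simps r left_mult_eq[OF r(1)] left_mult_eq[OF r(2)] left_mult_eq[OF r(3)]
       ss ss' pq qp pq_left qp_left
       scalar_left[OF s, of x] scalar_left[OF s, of y] scalar_left[OF s, of z] scalar_left[OF s, of s']
       scalar_left[OF s', of x] scalar_left[OF s', of y] scalar_left[OF s', of z]
      central_left[of x] central_left[of y] central_left[of z] central_left[of s] central_left[of s'])
qed

text \<open>With \<open>L\<close> and \<open>R\<close> the left and right multiplication by \<open>a\<close>, \<open>serre_form a\<close> is the product of the
  three commuting maps \<open>L - R\<close>, \<open>L - q\<^sup>2 R\<close> and \<open>L - q\<^sup>-\<^sup>2 R\<close>. The last one sends \<open>y\<close> to a scalar, the
  middle one sends \<open>w\<close> to a scalar, and \<open>L - R\<close> kills scalars and sends \<open>y * w\<close> to a multiple of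
  \<open>w - y\<close>, on which the two contributions of the other factors cancel.\<close>

lemma serre_shift:
  assumes s: "\<And>x. x * s = s * x" and "weyl a y" and "weyl w a"
  shows "serre_form a (y - s * (y * w - 1)) = 0" "serre_form a (w - s * (y * w - 1)) = 0"
proof -
  note r = assms(2)[unfolded weyl_left] assms(3)[unfolded weyl_right]
  show "serre_form a (y - s * (y * w - 1)) = 0" "serre_form a (w - s * (y * w - 1)) = 0"
  unfolding serre_form_def power3_eq_cube power2_eq_square
    by (simp_all add: algebra_simps r left_mult_eq[OF r(1)] left_mult_eq[OF r(2)]
       pq qp pq_left qp_left scalar_left[OF s, of a]
       scalar_left[OF s, of w] scalar_left[OF s, of y]
      central_left[of a] central_left[of y] central_left[of w] central_left[of s])
qed

text \<open>The element on the left is a shift of \<open>z\<close>, and the equation exhibits it as a shift of \<open>l\<close>. This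
  makes its relations with \<open>l\<close> and with the inverse of \<open>l\<close> accessible. It comes from the
  commutation of \<open>y\<close> with \<open>z * l\<close> up to a combination of \<open>z\<close> and \<open>l\<close>.\<close>

lemma shift_transfer:
  assumes s: "\<And>x. x * s = s * x" and s': "\<And>x. x * s' = s' * x" and ss: "s * s' = q * q"
    and "weyl l y" "weyl y z"
    and x: "x = l - s * (l * y - 1)" and g: "g = z - s * (y * z - 1)"
  shows "z - s' * (z * x - 1) = l - s' * (g * l - 1)"
proof -
  note r = assms(4)[unfolded weyl_right] assms(5)[unfolded weyl_left]
  have ss': "s * (s' * v) = q * (q * v)" for v by (simp add: mult.assoc[symmetric] ss)
  show ?thesis unfolding x g
    by (simp add: algebra_simps r left_mult_eq[OF r(1)] left_mult_eq[OF r(2)]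
       ss ss' pq qp pq_left qp_left
       scalar_left[OF s, of l] scalar_left[OF s, of y] scalar_left[OF s, of z] scalar_left[OF s, of s']
       scalar_left[OF s', of l] scalar_left[OF s', of y] scalar_left[OF s', of z]
      central_left[of l] central_left[of y] central_left[of z] central_left[of s] central_left[of s'])
qed

text \<open>This brings $x_{23}$ into the form that \<open>serre_shift\<close> needs for the cubic relation with $x_{01}$:
  a shift built from elements that both satisfy a $q$-Weyl relation with $x_{01}$.\<close>

lemma shift_back:
  assumes s: "\<And>x. x * s = s * x" and s': "\<And>x. x * s' = s' * x" and ss: "s * s' = q * q"
    and "weyl y z" and inv: "z * z' = 1" "z' * z = 1" and g: "g = z - s * (y * z - 1)"
  shows "y = z' - s' * (z' * g - 1)"
proof -
  have "z' * (y * z) = z' * (p * (p * (z * y)) + 1 - p * p)"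
    using assms(4)[unfolded weyl_left] by simp
  then have k: "z' * (y * z) = p * (p * y) + z' - p * (p * z')"
    by (simp add: algebra_simps central_left[of z'] left_mult_eq[OF inv(2)])
  have ss': "s * (s' * v) = q * (q * v)" for v by (simp add: mult.assoc[symmetric] ss)
  show ?thesis unfolding g
    by (simp add: algebra_simps k inv ss ss' pq qp pq_left qp_left
       scalar_left[OF s, of z'] scalar_left[OF s, of y] scalar_left[OF s, of z] scalar_left[OF s, of s']
       scalar_left[OF s', of z'] scalar_left[OF s', of y] scalar_left[OF s', of z]
      central_left[of z'] central_left[of y] central_left[of z] central_left[of s] central_left[of s'])
qed

text \<open>For matrices only the four $q$-Weyl relations and the three shift formulas among the hypotheses
  have to be compared entry by entry. Everything else is formal, in particular the cubic relations,
  whose entrywise verification would involve fourfold products.\<close>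

lemma evaluation_relations:
  assumes s: "\<And>x. x * s = s * x" and s': "\<And>x. x * s' = s' * x" and ss: "s * s' = q * q"
    and w: "weyl x02 x23" "weyl x23 x31" "weyl x31 x12" "weyl x30 x02"
    and x12: "x12 = x02 - s * (x02 * x23 - 1)"
    and x30: "x30 = x31 - s * (x23 * x31 - 1)"
    and x01: "x01 = x31 - s' * (x31 * x12 - 1)"
    and inv: "x31 * x13 = 1" "x13 * x31 = 1" "x02 * x20 = 1" "x20 * x02 = 1"
  shows "weyl x01 x12" "weyl x12 x23" "weyl x23 x30" "weyl x30 x01"
    and "weyl x01 x13" "weyl x12 x20" "weyl x13 x30" "weyl x20 x01"
    and "serre_form x01 x23 = 0" "serre_form x12 x30 = 0" "serre_form x23 x01 = 0" "serre_form x30 x12 = 0"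
proof -
  have x01': "x01 = x02 - s' * (x30 * x02 - 1)"
    unfolding x01 by (rule shift_transfer[OF s s' ss w(1,2) x12 x30])
  have x23: "x23 = x13 - s' * (x13 * x30 - 1)"
    by (rule shift_back[OF s s' ss w(2) inv(1,2) x30])
  show r: "weyl x01 x12" "weyl x12 x23" "weyl x23 x30"
    using weyl_shift_left[OF s' w(3)] weyl_shift_left[OF s w(1)] weyl_shift_right[OF s w(2)]
    by (simp_all add: x01[symmetric] x12[symmetric] x30[symmetric])
  show r': "weyl x30 x01"
    using weyl_opposite[OF s s' ss r(2) w(2,3)] by (simp add: x01[symmetric] x30[symmetric])
  show i: "weyl x01 x13" "weyl x12 x20"
    using weyl_inverse_right[OF s' w(3) inv(1,2)] weyl_inverse_right[OF s w(1) inv(3,4)]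
    by (simp_all add: x01[symmetric] x12[symmetric])
  show "weyl x13 x30" "weyl x20 x01"
    using weyl_inverse_left[OF s w(2) inv(1,2)] weyl_inverse_left[OF s' w(4) inv(3,4)]
    by (simp_all add: x01'[symmetric] x30[symmetric])
  show "serre_form x01 x23 = 0"
    using serre_shift(1)[OF s' i(1) r'] by (simp add: x23[symmetric])
  show "serre_form x12 x30 = 0"
    using serre_shift(2)[OF s r(2) w(3)] by (simp add: x30[symmetric])
  show "serre_form x23 x01 = 0"
    using serre_shift(1)[OF s' w(2) r(2)] by (simp add: x01[symmetric])
  show "serre_form x30 x12 = 0"
    using serre_shift(1)[OF s w(4) r(3)] by (simp add: x12[symmetric])
qed

end

section \<open>The ring of linear maps on sequences\<close>

text \<open>The identities above live in a ring type, while the size of the matrices is a variable. Linear maps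
  on all sequences form one ring that contains the matrices of every size.\<close>

typedef (overloaded) 'f lin = "{h :: (nat \<Rightarrow> 'f::field) \<Rightarrow> nat \<Rightarrow> 'f.
    (\<forall>a b. h (a + b) = h a + h b) \<and> (\<forall>c a. h (fun_scale c a) = fun_scale c (h a))}"
  morphisms app Lin
  by (rule exI[of _ id]) simp

lemma app_add: "app h (a + b) = app h a + app h b"
  and app_scale: "app h (fun_scale c a) = fun_scale c (app h a)"
  using app[of h] by auto

lemma lin_eqI: "(\<And>a i. app g a i = app h a i) \<Longrightarrow> g = h"
  by (metis app_inject ext)

instantiation lin :: (field) ring_1
begin

definition "0 = Lin (\<lambda>a. 0)"
definition "1 = Lin (\<lambda>a. a)"
definition "g + h = Lin (\<lambda>a. app g a + app h a)"
definition "g - h = Lin (\<lambda>a. app g a - app h a)"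
definition "- h = Lin (\<lambda>a. - app h a)"
definition "g * h = Lin (\<lambda>a. app g (app h a))"

lemma app_simps:
  "app 0 a = 0" "app 1 a = a" "app (g + h) a = app g a + app h a"
  "app (g - h) a = app g a - app h a" "app (- h) a = - app h a"
  "app (g * h) a = app g (app h a)"
  unfolding zero_lin_def one_lin_def plus_lin_def minus_lin_def uminus_lin_def times_lin_def
  by (subst Lin_inverse; auto simp: app_add app_scale[unfolded fun_scale_def] fun_scale_def fun_eq_iff algebra_simps)+

instance
  by standard (auto intro!: lin_eqI simp: app_simps app_add algebra_simps,
    metis app_simps(1,2) zero_neq_one)

end

definition scalar :: "'f::field \<Rightarrow> 'f lin" where
  "scalar c = Lin (fun_scale c)"

lemma app_scalar: "app (scalar c) a = fun_scale c a"
  unfolding scalar_def by (subst Lin_inverse) (auto simp: fun_scale_def algebra_simps)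

lemma scalar_central: "x * scalar c = scalar c * x"
  by (rule lin_eqI) (simp add: app_simps app_scalar app_scale)

lemma scalar_simps:
  "scalar 0 = 0" "scalar 1 = 1" "scalar (a + b) = scalar a + scalar b"
  "scalar (a - b) = scalar a - scalar b" "scalar (a * b) = scalar a * scalar b"
  by (rule lin_eqI; simp add: app_simps app_scalar fun_scale_def algebra_simps)+

lemma central_unit_scalar:
  assumes "q \<noteq> 0"
  shows "central_unit (scalar q) (scalar (inverse q))"
  using assms by unfold_locales
    (rule scalar_central[symmetric], rule scalar_central[symmetric], simp flip: scalar_simps)

section \<open>Matrices as linear maps\<close>

text \<open>Acting as the identity on the coordinates beyond \<open>d\<close>, and not as zero, turns the unit matrix into
  the unit of the ring. It adds copies of the trivial module to a representation by matrices, and on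
  the trivial module every relation of the $q$-tetrahedron algebra holds.\<close>

definition block_op :: "nat \<Rightarrow> 'f::field mat \<Rightarrow> 'f lin" where
  "block_op d M = Lin (\<lambda>a i. if i \<le> d then mat_op d M a i else a i)"

lemma app_block_op: "app (block_op d M) a i = (if i \<le> d then mat_op d M a i else a i)"
  unfolding block_op_def
  by (subst Lin_inverse)
    (auto simp: mat_op_def fun_scale_def fun_eq_iff sum.distrib algebra_simps sum_distrib_left)

lemma block_op_one: "block_op d (1\<^sub>m (d + 1)) = 1"
proof (rule lin_eqI)
  fix a :: "nat \<Rightarrow> 'a" and i
  have "(\<Sum>n\<le>d. 1\<^sub>m (Suc d) $$ (i, n) * a n) = (\<Sum>n\<le>d. if n = i then a n else 0)" if "i \<le> d"
    by (rule sum.cong) (use that in auto)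
  then show "app (block_op d (1\<^sub>m (d + 1))) a i = app 1 a i"
    by (auto simp: app_block_op app_simps mat_op_def)
qed

lemma block_op_mult:
  assumes "M \<in> carrier_mat (d + 1) (d + 1)" "N \<in> carrier_mat (d + 1) (d + 1)"
  shows "block_op d (M * N) = block_op d M * block_op d N"
proof (rule lin_eqI)
  fix a :: "nat \<Rightarrow> 'a" and i
  have *: "{0..<Suc d} = {..d}" by auto
  have "(\<Sum>n\<le>d. (M * N) $$ (i, n) * a n) = (\<Sum>m\<le>d. M $$ (i, m) * (\<Sum>n\<le>d. N $$ (m, n) * a n))"
    if "i \<le> d"
  proof -
    have "(\<Sum>n\<le>d. (M * N) $$ (i, n) * a n) = (\<Sum>n\<le>d. \<Sum>m\<le>d. M $$ (i, m) * N $$ (m, n) * a n)"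
      by (rule sum.cong) (use that assms in \<open>auto simp: scalar_prod_def sum_distrib_right *\<close>)
    also have "\<dots> = (\<Sum>m\<le>d. \<Sum>n\<le>d. M $$ (i, m) * N $$ (m, n) * a n)"
      by (rule sum.swap)
    finally show ?thesis by (simp add: sum_distrib_left mult.assoc)
  qed
  then show "app (block_op d (M * N)) a i = app (block_op d M * block_op d N) a i"
    by (auto simp: app_block_op app_simps mat_op_def intro!: sum.cong)
qed

lemma mat_inv:
  assumes M: "M \<in> carrier_mat n n" and "det M \<noteq> 0"
  shows "mat_inv M \<in> carrier_mat n n" "M * mat_inv M = 1\<^sub>m n" "mat_inv M * M = 1\<^sub>m n"
proof -
  obtain B where B: "B \<in> carrier_mat n n" "B * M = 1\<^sub>m n" "M * B = 1\<^sub>m n"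
    using det_non_zero_imp_unit[OF M assms(2), unfolded Units_def ring_mat_def, of undefined] by auto
  have "mat_inv M = B"
    unfolding mat_inv_def
  proof (rule the_equality)
    show "inverts_mat M B \<and> inverts_mat B M" using M B by (simp add: inverts_mat_def)
    fix C assume C: "inverts_mat M C \<and> inverts_mat C M"
    then have *: "M * C = 1\<^sub>m n" "C * M = 1\<^sub>m (dim_row C)"
      using M by (auto simp: inverts_mat_def)
    have "dim_col C = n" using arg_cong[OF *(1), of dim_col] by simp
    moreover have "dim_row C = n" using arg_cong[OF *(2), of dim_col] M by simp
    ultimately have C: "C \<in> carrier_mat n n" by auto
    have "C = (B * M) * C" using B C by simp
    also have "\<dots> = B * (M * C)" by (rule assoc_mult_mat[OF B(1) M C])
    also have "\<dots> = B" using *(1) B by simp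
    finally show "C = B" .
  qed
  then show "mat_inv M \<in> carrier_mat n n" "M * mat_inv M = 1\<^sub>m n" "mat_inv M * M = 1\<^sub>m n"
    using B by auto
qed

lemma block_op_mat_inv:
  assumes "M \<in> carrier_mat (d + 1) (d + 1)" and "det M \<noteq> 0"
  shows "block_op d M * block_op d (mat_inv M) = 1" "block_op d (mat_inv M) * block_op d M = 1"
  using mat_inv[OF assms] assms(1) by (metis block_op_mult block_op_one)+

lemma matZ_conj:
  assumes "M \<in> carrier_mat (d + 1) (d + 1)" "r \<le> d" "c \<le> d"
  shows "(matZ d * M * matZ d) $$ (r, c) = M $$ (d - r, d - c)"
proof -
  have *: "{0..<Suc d} = {..d}" by auto
  have 1: "(matZ d * M) $$ (i, j) = M $$ (d - i, j)" if "i \<le> d" "j \<le> d" for i j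
  proof -
    have "(matZ d * M) $$ (i, j) = (\<Sum>m\<le>d. (if i + m = d then 1 else 0) * M $$ (m, j))"
      using that assms(1) by (simp add: matZ_def scalar_prod_def *)
    also have "\<dots> = (\<Sum>m\<le>d. if m = d - i then M $$ (m, j) else 0)"
      by (rule sum.cong) (use that in auto)
    finally have "(matZ d * M) $$ (i, j) = (\<Sum>m\<le>d. if m = d - i then M $$ (m, j) else 0)" .
    then show ?thesis by simp
  qed
  have "(matZ d * M * matZ d) $$ (r, c) = row (matZ d * M) r \<bullet> col (matZ d) c"
    by (rule index_mult_mat(1)) (use assms in \<open>simp_all add: matZ_def\<close>)
  also have "\<dots> = (\<Sum>m\<le>d. (matZ d * M) $$ (r, m) * (if m + c = d then 1 else 0))"
    unfolding scalar_prod_def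
    by (rule sum.cong) (use assms in \<open>auto simp: matZ_def\<close>)
  also have "\<dots> = (\<Sum>m\<le>d. if m = d - c then M $$ (d - r, m) else 0)"
    by (rule sum.cong) (use assms 1 in auto)
  finally show ?thesis by simp
qed

section \<open>Bidiagonal maps\<close>

locale nonroot =
  fixes q :: "'f::field" and d :: nat
  assumes q0: "q \<noteq> 0" and nonroot: "n > 0 \<Longrightarrow> q ^ n \<noteq> 1"
begin

text \<open>The diagonal entry in row \<open>r\<close> of all the triangular representing matrices; the eigenvalue of
  $x_{23}$ is its inverse.\<close>

definition kap :: "nat \<Rightarrow> 'f" where "kap r = q powi (2 * int r - int d)"

lemma kap_0: "kap 0 = inverse (q ^ d)"
  by (simp add: kap_def power_int_minus)

lemma kap_d: "kap d = q ^ d"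
  by (simp add: kap_def)

lemma kap_nz [simp]: "kap r \<noteq> 0"
  using q0 by (simp add: kap_def)

lemma kap_Suc: "kap (Suc r) = q\<^sup>2 * kap r"
proof -
  have "kap (Suc r) = q powi (2 + (2 * int r - int d))" by (simp add: kap_def algebra_simps)
  also have "\<dots> = q\<^sup>2 * kap r" using q0 by (subst power_int_add) (simp_all add: kap_def)
  finally show ?thesis .
qed

lemma powi_kap:
  "q powi (2 * int r - int d) = kap r"
  "q powi (int d - 2 * int r) = inverse (kap r)"
  "q powi (int d - 2 * int r - 1) = inverse q * inverse (kap r)"
  "q powi (int d - 2 * int r + 1) = q * inverse (kap r)"
  "q powi (2 * int r - int d - 1) = inverse q * kap r"
  "q powi (2 * int r - int d + 1) = q * kap r"
  "q powi (int d) = q ^ d"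
  "q powi (- int d) = inverse (q ^ d)"
proof -
  show "q powi (2 * int r - int d) = kap r" by (simp add: kap_def)
  show "q powi (int d - 2 * int r) = inverse (kap r)"
    by (simp add: kap_def flip: power_int_minus)
  then show "q powi (int d - 2 * int r - 1) = inverse q * inverse (kap r)"
    "q powi (int d - 2 * int r + 1) = q * inverse (kap r)"
    using q0 by (simp_all add: power_int_diff power_int_add field_simps)
  show "q powi (2 * int r - int d - 1) = inverse q * kap r"
    "q powi (2 * int r - int d + 1) = q * kap r"
    using q0 by (simp_all add: power_int_diff power_int_add kap_def field_simps)
qed (simp_all add: power_int_minus)

lemma powi_inj: "q powi m = q powi n \<longleftrightarrow> m = n"
proof
  have *: "False" if "q powi m = q powi n" "m < n" for m n
  proof -
    have "q powi (n - m) = 1" using that q0 by (simp add: power_int_diff)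
    then have "q ^ nat (n - m) = 1" using that by (simp add: power_int_def)
    then show False using nonroot[of "nat (n - m)"] that by simp
  qed
  show "m = n" if "q powi m = q powi n"
    using *[of m n] *[of n m] that by (metis linorder_neqE)
qed simp

lemma kap_inj: "kap r = kap s \<longleftrightarrow> r = s"
  by (auto simp: kap_def powi_inj)

text \<open>Rows are read as formulas for the image of a sequence \<open>a\<close>. The off-diagonal coefficient is
  required to vanish in the row where it would couple to a coordinate outside the block; for \<open>i = 0\<close>
  the truncated index \<open>i - 1\<close> is therefore harmless.\<close>

definition upper :: "'f lin \<Rightarrow> (nat \<Rightarrow> 'f) \<Rightarrow> bool" where
  "upper h u \<longleftrightarrow> u d = 0 \<and>
     (\<forall>a i. app h a i = (if i \<le> d then kap i * a i + u i * a (Suc i) else a i))"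

definition lower :: "'f lin \<Rightarrow> (nat \<Rightarrow> 'f) \<Rightarrow> bool" where
  "lower h v \<longleftrightarrow> v 0 = 0 \<and>
     (\<forall>a i. app h a i = (if i \<le> d then kap i * a i + v i * a (i - 1) else a i))"

sublocale central_unit "scalar q" "scalar (inverse q)"
  by (rule central_unit_scalar[OF q0])

lemma weyl_iff:
  "weyl x y \<longleftrightarrow> (\<forall>a i. q * app x (app y a) i - inverse q * app y (app x a) i = (q - inverse q) * a i)"
proof -
  have "weyl x y \<longleftrightarrow> (\<forall>a. app (scalar q * x * y - scalar (inverse q) * y * x) a
      = app (scalar q - scalar (inverse q)) a)"
    unfolding weyl_def by (metis lin_eqI)
  then show ?thesis
    by (simp add: app_simps app_scalar fun_eq_iff fun_scale_def left_diff_distrib)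
qed

lemma weyl_upper_diag:
  assumes l: "upper l u" and k: "\<And>a i. app k a i = (if i \<le> d then inverse (kap i) * a i else a i)"
  shows "weyl l k"
  unfolding weyl_iff
proof (intro allI)
  fix a i
  show "q * app l (app k a) i - inverse q * app k (app l a) i = (q - inverse q) * a i"
    using l q0 by (cases "i < d"; cases "i = d")
      (auto simp: upper_def k kap_Suc field_simps power2_eq_square power4_eq_xxxx)
qed

lemma weyl_diag_lower:
  assumes l: "lower l v" and k: "\<And>a i. app k a i = (if i \<le> d then inverse (kap i) * a i else a i)"
  shows "weyl k l"
  unfolding weyl_iff
proof (intro allI)
  fix a i
  show "q * app k (app l a) i - inverse q * app l (app k a) i = (q - inverse q) * a i"
    using l q0 by (cases i) (auto simp: lower_def k kap_Suc field_simps power2_eq_square power4_eq_xxxx)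
qed

text \<open>The value that the $q$-Weyl relation forces on the product of the entries in positions
  \<open>(i, i + 1)\<close> and \<open>(i + 1, i)\<close> of an upper and a lower bidiagonal matrix with diagonal \<open>kap\<close>.\<close>

definition edge_product :: "nat \<Rightarrow> 'f" where
  "edge_product i = (q ^ d - kap i) * (inverse (q ^ d) - q\<^sup>2 * kap i)"

lemma weyl_lower_upper:
  assumes h: "lower h v" and l: "upper l u" and uv: "\<And>i. i < d \<Longrightarrow> u i * v (Suc i) = edge_product i"
  shows "weyl h l"
  unfolding weyl_iff
proof (intro allI)
  fix a i
  have hl: "app h (app l a) i = (kap i)\<^sup>2 * a i + kap i * u i * a (Suc i)
      + (if i = 0 then 0 else v i * kap (i - 1) * a (i - 1) + edge_product (i - 1) * a i)" if "i \<le> d"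
    using h l that uv[of "i - 1"]
    by (cases i) (auto simp: lower_def upper_def algebra_simps power2_eq_square)
  have lh: "app l (app h a) i = (kap i)\<^sup>2 * a i + kap i * v i * a (i - 1)
      + u i * kap (Suc i) * a (Suc i) + edge_product i * a i" if "i \<le> d"
  proof (cases "i = d")
    case True
    then show ?thesis
      using h l by (auto simp: lower_def upper_def algebra_simps power2_eq_square edge_product_def kap_d)
  next
    case False
    then show ?thesis
      using h l that by (auto simp: lower_def upper_def algebra_simps power2_eq_square simp flip: uv)
  qed
  show "q * app h (app l a) i - inverse q * app l (app h a) i = (q - inverse q) * a i"
  proof (cases "i \<le> d")
    case True
    show ?thesis
    proof (cases i)
      case 0
      with h q0 show ?thesis
        unfolding hl[OF True] lh[OF True]
        by (simp add: lower_def kap_Suc edge_product_def kap_0) (simp add: field_simps power2_eq_square power4_eq_xxxx)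
    next
      case (Suc j)
      with True q0 show ?thesis
        unfolding hl[OF True] lh[OF True]
        by (simp add: kap_Suc edge_product_def) (simp add: field_simps power2_eq_square power4_eq_xxxx)
    qed
  next
    case False
    with h l show ?thesis by (simp add: lower_def upper_def algebra_simps)
  qed
qed

text \<open>Multiplying the off-diagonal entries by a factor that is affine in the eigenvalue of \<open>k\<close> is a shift
  in the sense of the ring identities. The factors of $G_q(t)$ and $L_q(t)$ that contain \<open>t\<close> are of this kind.\<close>

lemma upper_combination:
  assumes l: "upper l u" and e: "upper e w"
    and k: "\<And>a i. app k a i = (if i \<le> d then inverse (kap i) * a i else a i)"
    and uw: "\<And>i. i < d \<Longrightarrow> w i = u i * (1 - t * inverse q * inverse (kap i))"
  shows "e = l - scalar (t * q) * (l * k - 1)"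
proof (rule lin_eqI)
  fix a i
  show "app e a i = app (l - scalar (t * q) * (l * k - 1)) a i"
    using l e q0 by (cases "i < d"; cases "i = d")
      (auto simp: upper_def k uw kap_Suc app_simps app_scalar fun_scale_def field_simps power2_eq_square power4_eq_xxxx)
qed

lemma lower_combination:
  assumes l: "lower l u" and e: "lower e w"
    and k: "\<And>a i. app k a i = (if i \<le> d then inverse (kap i) * a i else a i)"
    and uw: "\<And>i. i \<le> d \<Longrightarrow> w i = u i * (1 - t * q * inverse (kap i))"
  shows "e = l - scalar (t * q) * (k * l - 1)"
proof (rule lin_eqI)
  fix a i
  show "app e a i = app (l - scalar (t * q) * (k * l - 1)) a i"
    using l e q0 by (cases "i \<le> d")
      (auto simp: lower_def k uw kap_Suc app_simps app_scalar fun_scale_def field_simps power2_eq_square power4_eq_xxxx)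
qed

text \<open>The tridiagonal matrix of $x_{01}$ is a shift of $x_{31}$ by $x_{12}$, with the inverse of the
  evaluation parameter.\<close>

lemma tridiagonal_combination:
  assumes h: "lower h v" and l: "upper l u"
    and v: "\<And>i. v i = inverse (q ^ d) - kap i" and u: "\<And>i. u i = q ^ d - kap i"
    and x: "\<And>a i. app x a i = (if i \<le> d then
        - (q ^ d - kap i) * (q * kap i) * s * a (Suc i)
        + (inverse (q ^ d) - (kap i - q ^ d) * (q * kap i) * s
            - (inverse (q ^ d) - kap i) * (1 - inverse q * kap i * s)) * a i
        + (inverse (q ^ d) - kap i) * (1 - inverse q * kap i * s) * a (i - 1) else a i)"
  shows "x = h - scalar (s * q) * (h * l - 1)"
proof (rule lin_eqI)
  fix a i
  show "app x a i = app (h - scalar (s * q) * (h * l - 1)) a i"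
  proof (cases "i \<le> d")
    case True
    show ?thesis
    proof (cases i)
      case 0
      with h l q0 show ?thesis
        by (simp add: x app_simps app_scalar fun_scale_def lower_def upper_def u kap_0)
          (simp add: field_simps power2_eq_square power4_eq_xxxx)
    next
      case (Suc j)
      with True h l q0 show ?thesis
        by (simp add: x app_simps app_scalar fun_scale_def lower_def upper_def u v kap_Suc)
          (simp add: field_simps power2_eq_square power4_eq_xxxx)
    qed
  next
    case False
    with h l show ?thesis
      by (simp add: x app_simps app_scalar fun_scale_def lower_def upper_def)
  qed
qed

end

section \<open>The representing matrices\<close>

lemma mat_op_banded:
  assumes "i \<le> d" and "\<And>n. n \<le> d \<Longrightarrow> n \<noteq> i \<Longrightarrow> n \<noteq> Suc i \<Longrightarrow> Suc n \<noteq> i \<Longrightarrow> M $$ (i, n) = 0"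
  shows "mat_op d M a i = (case i of 0 \<Rightarrow> 0 | Suc j \<Rightarrow> M $$ (i, j) * a j) + M $$ (i, i) * a i
    + (if i = d then 0 else M $$ (i, Suc i) * a (Suc i))"
proof -
  let ?S = "(if i = 0 then {} else {i - 1}) \<union> {i} \<union> (if i = d then {} else {Suc i})"
  have "(\<Sum>n\<le>d. M $$ (i, n) * a n) = (\<Sum>n\<in>?S. M $$ (i, n) * a n)"
    by (rule sum.mono_neutral_right) (use assms in auto)
  also have "\<dots> = (case i of 0 \<Rightarrow> 0 | Suc j \<Rightarrow> M $$ (i, j) * a j) + M $$ (i, i) * a i
    + (if i = d then 0 else M $$ (i, Suc i) * a (Suc i))"
    by (cases i) auto
  finally show ?thesis using assms(1) by (simp add: mat_op_def)
qed

lemma mat_carrier: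
  "matK d q \<in> carrier_mat (d + 1) (d + 1)" "matE d q \<in> carrier_mat (d + 1) (d + 1)"
  "matL d q t \<in> carrier_mat (d + 1) (d + 1)" "matG d q t \<in> carrier_mat (d + 1) (d + 1)"
  "matS d q t \<in> carrier_mat (d + 1) (d + 1)" "matZ d \<in> carrier_mat (d + 1) (d + 1)"
  by (simp_all add: matK_def matE_def matL_def matG_def matS_def matZ_def)

context nonroot
begin

lemma inverse_powi: "inverse q powi m = q powi (- m)"
  by (simp add: power_int_inverse power_int_minus)

lemma powi_eqs:
  "m = 2 * int r - int d \<Longrightarrow> q powi m = kap r"
  "m = int d - 2 * int r \<Longrightarrow> q powi m = inverse (kap r)"
  "m = int d - 2 * int r - 1 \<Longrightarrow> q powi m = inverse q * inverse (kap r)"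
  "m = int d - 2 * int r + 1 \<Longrightarrow> q powi m = q * inverse (kap r)"
  "m = 2 * int r - int d - 1 \<Longrightarrow> q powi m = inverse q * kap r"
  "m = 2 * int r - int d + 1 \<Longrightarrow> q powi m = q * kap r"
  "m = - int d \<Longrightarrow> q powi m = inverse (q ^ d)"
  by (simp_all add: powi_kap)

lemma matK_entry:
  assumes "r \<le> d" "c \<le> d"
  shows "matK d q $$ (r, c) = (if r = c then inverse (kap r) else 0)"
  using assms by (simp add: matK_def powi_kap)

lemma matE_entry:
  assumes "r \<le> d" "c \<le> d"
  shows "matE d q $$ (r, c) = (if r = c then kap r else if c = Suc r then q ^ d - kap r else 0)"
  using assms by (auto simp: matE_def powi_eqs(1)[of _ r])

lemma matL_entry:
  assumes "r \<le> d" "c \<le> d"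
  shows "matL d q t $$ (r, c) = (if r = c then kap r else if c = Suc r
    then (q ^ d - kap r) * inverse (1 - t * inverse q * inverse (kap r)) else 0)"
  using assms by (auto simp: matL_def powi_eqs(1)[of _ r] powi_eqs(3)[of _ r])

lemma matE_conj_entry:
  assumes "r \<le> d" "c \<le> d"
  shows "(matZ d * matE d (inverse q) * matZ d) $$ (r, c) =
    (if r = c then kap r else if r = Suc c then inverse (q ^ d) - kap r else 0)"
  using assms by (subst matZ_conj) (auto simp: matE_def inverse_powi power_inverse of_nat_diff powi_eqs(1)[of _ r]
    powi_eqs(7))

lemma inverse_powi_eqs:
  "r \<le> d \<Longrightarrow> m = 2 * int (d - r) - int d \<Longrightarrow> inverse q powi m = kap r"
  "r \<le> d \<Longrightarrow> m = int d - 2 * int (d - r) - 1 \<Longrightarrow> inverse q powi m = q * inverse (kap r)"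
  "r \<le> d \<Longrightarrow> m = 2 * int (d - r) - int d - 1 \<Longrightarrow> inverse q powi m = q * kap r"
  "r \<le> d \<Longrightarrow> m = 2 * int (d - r) - int d + 1 \<Longrightarrow> inverse q powi m = inverse q * kap r"
  unfolding inverse_powi
  by (rule powi_eqs; simp add: of_nat_diff)+

lemma matG_conj_entry:
  assumes "r \<le> d" "c \<le> d"
  shows "(matZ d * matG d (inverse q) t * matZ d) $$ (r, c) =
    (if r = c then kap r else if r = Suc c
     then (inverse (q ^ d) - kap r) * (1 - t * q * inverse (kap r)) else 0)"
proof (cases "r = Suc c")
  case True
  then have *: "d - c = Suc (d - r)" using assms by simp
  have e: "inverse q powi (2 * int (Suc (d - r)) - 2 - int d) = kap r"
    "inverse q powi (int d - 2 * int (Suc (d - r)) + 1) = q * inverse (kap r)"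
    by (rule inverse_powi_eqs(1,2,3,4)[OF assms(1)]; simp; fail)+
  show ?thesis
    using True assms * e by (simp add: matZ_conj mat_carrier matG_def power_inverse mult.assoc)
next
  case False
  then show ?thesis
    using assms inverse_powi_eqs(1)[OF assms(1) refl]
    by (auto simp: matZ_conj mat_carrier matG_def)
qed

lemma matS_conj_entry:
  assumes "r \<le> d" "c \<le> d"
  shows "(matZ d * matS d (inverse q) t * matZ d) $$ (r, c) =
    (if c = Suc r then - (q ^ d - kap r) * (q * kap r) * t
     else if r = c then inverse (q ^ d) - (kap r - q ^ d) * (q * kap r) * t
            - (inverse (q ^ d) - kap r) * (1 - inverse q * kap r * t)
     else if r = Suc c then (inverse (q ^ d) - kap r) * (1 - inverse q * kap r * t) else 0)"
proof -
  note e = inverse_powi_eqs(1,3,4)[OF assms(1) refl]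
  consider "r = Suc c" | "c = Suc r" | "r = c" | "r \<noteq> Suc c" "c \<noteq> Suc r" "r \<noteq> c" by blast
  then show ?thesis
  proof cases
    case 1
    then have *: "d - c = Suc (d - r)" using assms by simp
    have e': "inverse q powi (2 * int (Suc (d - r)) - int d - 2) = kap r"
      "inverse q powi (2 * int (Suc (d - r)) - int d - 1) = inverse q * kap r"
      by (rule inverse_powi_eqs(1,2,3,4)[OF assms(1)]; simp; fail)+
    show ?thesis
      using 1 assms * e' by (simp add: matZ_conj mat_carrier matS_def power_inverse mult_ac)
  next
    case 2
    then have *: "d - r = Suc (d - c)" using assms by simp
    show ?thesis
      using 2 assms e[unfolded *]
      by (simp add: matZ_conj mat_carrier matS_def * power_inverse power_int_minus)
  next
    case 3
    then show ?thesis
      using assms e by (simp add: matZ_conj mat_carrier matS_def power_inverse power_int_minus mult_ac)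
  next
    case 4
    then have "d - r \<noteq> Suc (d - c)" "d - c \<noteq> Suc (d - r)" "d - r \<noteq> d - c" using assms by auto
    with 4 assms show ?thesis by (simp add: matZ_conj mat_carrier matS_def)
  qed
qed

end

lemma index_cases: "(i::4) = 0 \<or> i = 1 \<or> i = 2 \<or> i = 3"
proof (cases i)
  case (of_int z)
  then have "z = 0 \<or> z = 1 \<or> z = 2 \<or> z = 3" by auto
  then show ?thesis using of_int by auto
qed

text \<open>Arithmetic modulo 4 is done once here, so that later case distinctions do not branch over all
  pairs of indices.\<close>

lemma index_diff:
  fixes i j :: 4
  shows "j - i = 1 \<longleftrightarrow> (i = 0 \<and> j = 1) \<or> (i = 1 \<and> j = 2) \<or> (i = 2 \<and> j = 3) \<or> (i = 3 \<and> j = 0)"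
    and "j - i = 2 \<longleftrightarrow> (i = 0 \<and> j = 2) \<or> (i = 1 \<and> j = 3) \<or> (i = 2 \<and> j = 0) \<or> (i = 3 \<and> j = 1)"
  by (insert index_cases[of i] index_cases[of j], (elim disjE; simp)+)

lemma gen_mat_simps:
  "gen_mat d q t 0 1 = matZ d * matS d (inverse q) (inverse t) * matZ d"
  "gen_mat d q t 1 2 = matE d q"
  "gen_mat d q t 2 3 = matK d q"
  "gen_mat d q t 3 0 = matZ d * matG d (inverse q) t * matZ d"
  "gen_mat d q t 0 2 = matL d q t"
  "gen_mat d q t 1 3 = mat_inv (matZ d * matE d (inverse q) * matZ d)"
  "gen_mat d q t 2 0 = mat_inv (matL d q t)"
  "gen_mat d q t 3 1 = matZ d * matE d (inverse q) * matZ d"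
  by (simp_all add: gen_mat_def)

context nonroot
begin

lemma prod_diag_nz:
  fixes M :: "'a::field mat"
  assumes "M \<in> carrier_mat n n" "\<And>i. i < n \<Longrightarrow> M $$ (i, i) \<noteq> 0"
  shows "prod_list (diag_mat M) \<noteq> 0"
  using assms by (auto simp: prod_list_zero_iff diag_mat_def)

lemma det_matL: "det (matL d q t) \<noteq> 0"
proof -
  have "det (matL d q t) = prod_list (diag_mat (matL d q t))"
    by (rule det_upper_triangular[OF _ mat_carrier(3)])
      (auto simp: upper_triangular_def matL_def)
  then show ?thesis
    using prod_diag_nz[OF mat_carrier(3), of d q t] by (simp add: matL_entry)
qed

lemma matE_conj_carrier: "matZ d * matE d (inverse q) * matZ d \<in> carrier_mat (d + 1) (d + 1)"
  using mat_carrier by (metis mult_carrier_mat)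

lemma det_matE_conj: "det (matZ d * matE d (inverse q) * matZ d) \<noteq> 0" (is "det ?M \<noteq> 0")
proof -
  have "det ?M = prod_list (diag_mat ?M)"
  proof (rule det_lower_triangular[OF _ matE_conj_carrier])
    show "?M $$ (i, j) = 0" if "i < j" "j < d + 1" for i j
      using that by (subst matE_conj_entry) auto
  qed
  also have "\<dots> \<noteq> 0"
    by (rule prod_diag_nz[OF matE_conj_carrier]) (subst matE_conj_entry; simp)
  finally show ?thesis .
qed

abbreviation gen_op :: "'f \<Rightarrow> 4 \<Rightarrow> 4 \<Rightarrow> 'f lin" where
  "gen_op t i j \<equiv> block_op d (gen_mat d q t i j)"

lemma upper_block:
  assumes "\<And>r c. r \<le> d \<Longrightarrow> c \<le> d \<Longrightarrow>
      M $$ (r, c) = (if r = c then kap r else if c = Suc r then u r else 0)" and "u d = 0"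
  shows "upper (block_op d M) u"
  unfolding upper_def
proof (intro conjI allI)
  show "app (block_op d M) a i = (if i \<le> d then kap i * a i + u i * a (Suc i) else a i)" for a i
    using assms by (auto simp: app_block_op mat_op_banded split: nat.split)
qed fact

lemma lower_block:
  assumes "\<And>r c. r \<le> d \<Longrightarrow> c \<le> d \<Longrightarrow>
      M $$ (r, c) = (if r = c then kap r else if r = Suc c then v r else 0)" and "v 0 = 0"
  shows "lower (block_op d M) v"
  unfolding lower_def
proof (intro conjI allI)
  show "app (block_op d M) a i = (if i \<le> d then kap i * a i + v i * a (i - 1) else a i)" for a i
    using assms by (auto simp: app_block_op mat_op_banded split: nat.split)
qed fact

lemma gen_op_23: "app (gen_op t 2 3) a i = (if i \<le> d then inverse (kap i) * a i else a i)"
  by (cases i) (simp_all add: app_block_op mat_op_banded gen_mat_simps matK_entry)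

lemma gen_op_12: "upper (gen_op t 1 2) (\<lambda>i. q ^ d - kap i)"
  by (rule upper_block) (simp_all add: gen_mat_simps matE_entry kap_d)

lemma gen_op_02: "upper (gen_op t 0 2)
    (\<lambda>i. (q ^ d - kap i) * inverse (1 - t * inverse q * inverse (kap i)))"
  by (rule upper_block) (simp_all add: gen_mat_simps matL_entry kap_d)

lemma gen_op_31: "lower (gen_op t 3 1) (\<lambda>i. inverse (q ^ d) - kap i)"
  by (rule lower_block) (simp_all add: gen_mat_simps matE_conj_entry kap_0)

lemma gen_op_30: "lower (gen_op t 3 0)
    (\<lambda>i. (inverse (q ^ d) - kap i) * (1 - t * q * inverse (kap i)))"
  by (rule lower_block) (simp_all add: gen_mat_simps matG_conj_entry kap_0)

lemma gen_op_01: "app (gen_op t 0 1) a i = (if i \<le> d then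
        - (q ^ d - kap i) * (q * kap i) * inverse t * a (Suc i)
        + (inverse (q ^ d) - (kap i - q ^ d) * (q * kap i) * inverse t
            - (inverse (q ^ d) - kap i) * (1 - inverse q * kap i * inverse t)) * a i
        + (inverse (q ^ d) - kap i) * (1 - inverse q * kap i * inverse t) * a (i - 1) else a i)"
  using matS_conj_entry[of _ _ "inverse t"] kap_0 kap_d
  by (auto simp: app_block_op mat_op_banded gen_mat_simps split: nat.split)

text \<open>The inequations say that the denominators in the matrix of $x_{02}$ do not vanish. The equivalence
  with the list of excluded powers of \<open>q\<close> is \<open>admissible_iff\<close>.\<close>

definition admissible :: "'f \<Rightarrow> bool" where
  "admissible t \<longleftrightarrow> t \<noteq> 0 \<and> (\<forall>i<d. t * inverse q * inverse (kap i) \<noteq> 1)"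

text \<open>The seven entrywise facts are the bidiagonal computations above, and the rest is formal.\<close>

lemma gen_op_relations:
  assumes "admissible t"
  shows gen_op_inv: "j - i = 2 \<Longrightarrow> gen_op t i j * gen_op t j i = 1"
    and gen_op_weyl: "(j - i, k - j) \<in> {(1, 1), (1, 2), (2, 1)} \<Longrightarrow> weyl (gen_op t i j) (gen_op t j k)"
    and gen_op_serre: "j - i = 1 \<Longrightarrow> k - j = 1 \<Longrightarrow> l - k = 1 \<Longrightarrow>
      serre_form (gen_op t i j) (gen_op t k l) = 0"
proof -
  have t: "t \<noteq> 0" and nz: "\<And>i. i < d \<Longrightarrow> 1 - t * inverse q * inverse (kap i) \<noteq> 0"
    using assms by (auto simp: admissible_def)
  have k: "app (gen_op t 2 3) a i = (if i \<le> d then inverse (kap i) * a i else a i)" for a i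
    by (rule gen_op_23)
  have w: "weyl (gen_op t 0 2) (gen_op t 2 3)" "weyl (gen_op t 2 3) (gen_op t 3 1)"
    by (rule weyl_upper_diag[OF gen_op_02 k] weyl_diag_lower[OF gen_op_31 k])+
  have w3: "weyl (gen_op t 3 1) (gen_op t 1 2)"
    by (rule weyl_lower_upper[OF gen_op_31 gen_op_12]) (simp add: edge_product_def kap_Suc)
  have w4: "weyl (gen_op t 3 0) (gen_op t 0 2)"
  proof (rule weyl_lower_upper[OF gen_op_30 gen_op_02])
    fix i assume i: "i < d"
    have e: "t * q * inverse (kap (Suc i)) = t * inverse q * inverse (kap i)"
      using q0 by (simp add: kap_Suc field_simps power2_eq_square)
    show "(q ^ d - kap i) * inverse (1 - t * inverse q * inverse (kap i)) *
         ((inverse (q ^ d) - kap (Suc i)) * (1 - t * q * inverse (kap (Suc i)))) = edge_product i"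
      unfolding e using nz[OF i] by (simp add: edge_product_def kap_Suc)
  qed
  have x12: "gen_op t 1 2 = gen_op t 0 2 - scalar (t * q) * (gen_op t 0 2 * gen_op t 2 3 - 1)"
    by (rule upper_combination[OF gen_op_02 gen_op_12 k])
      (subst mult.assoc, subst left_inverse[OF nz], simp_all)
  have x30: "gen_op t 3 0 = gen_op t 3 1 - scalar (t * q) * (gen_op t 2 3 * gen_op t 3 1 - 1)"
    by (rule lower_combination[OF gen_op_31 gen_op_30 k]) simp
  have x01: "gen_op t 0 1 = gen_op t 3 1 - scalar (inverse t * q) * (gen_op t 3 1 * gen_op t 1 2 - 1)"
    by (rule tridiagonal_combination[OF gen_op_31 gen_op_12 _ _ gen_op_01]) simp_all
  have inv: "gen_op t 3 1 * gen_op t 1 3 = 1" "gen_op t 1 3 * gen_op t 3 1 = 1"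
    "gen_op t 0 2 * gen_op t 2 0 = 1" "gen_op t 2 0 * gen_op t 0 2 = 1"
    unfolding gen_mat_simps
    using block_op_mat_inv[OF matE_conj_carrier det_matE_conj] block_op_mat_inv[OF mat_carrier(3) det_matL]
    by simp_all
  have ss: "scalar (t * q) * scalar (inverse t * q) = scalar q * scalar q"
    using t by (simp flip: scalar_simps) (simp add: field_simps)
  note r = evaluation_relations[OF scalar_central scalar_central ss w w3 w4 x12 x30 x01 inv]
  show "gen_op t i j * gen_op t j i = 1" if "j - i = 2"
    using that[unfolded index_diff] inv by (elim disjE conjE) simp_all
  show "weyl (gen_op t i j) (gen_op t j k)" if "(j - i, k - j) \<in> {(1, 1), (1, 2), (2, 1)}"
  proof -
    have "j - i = 1 \<and> k - j = 1 \<or> j - i = 1 \<and> k - j = 2 \<or> j - i = 2 \<and> k - j = 1"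
      using that by blast
    then show ?thesis
      unfolding index_diff using r w w3 w4 by (elim disjE conjE) simp_all
  qed
  show "serre_form (gen_op t i j) (gen_op t k l) = 0" if "j - i = 1" "k - j = 1" "l - k = 1"
  proof -
    have "j = i + 1" "k = i + 2" "l = i + 3"
      using that by (simp_all add: diff_eq_eq)
    moreover have "(4::4) = 0" "(5::4) = 1" "(6::4) = 2" by simp_all
    ultimately show ?thesis using index_cases[of i] r(9-12) by (elim disjE) simp_all
  qed
qed

end

section \<open>Representations of the free algebra\<close>

lemma free_alg_induct_single [case_names single add]:
  assumes "\<And>w c. P (Poly_Mapping.single w c)" and "\<And>p r. P p \<Longrightarrow> P r \<Longrightarrow> P (p + r)"
  shows "P (p :: 'f::field free_alg)"
proof -
  have "P (\<Sum>w\<in>A. Poly_Mapping.single w (Poly_Mapping.lookup p w))" if "finite A" for A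
    using that
  proof (induction A)
    case empty
    show ?case using assms(1)[of 0 0] by simp
  qed (simp add: assms)
  moreover have "(\<Sum>w\<in>Poly_Mapping.keys p. Poly_Mapping.single w (Poly_Mapping.lookup p w)) = p"
    by (rule poly_mapping_eqI)
      (simp add: lookup_sum lookup_single when_def in_keys_iff sum.delta')
  ultimately show ?thesis by (metis finite_keys)
qed

text \<open>To compare two actions it suffices to follow a generator multiplied from the left, which is how a
  word acts.\<close>

lemma free_alg_induct [case_names const var add]:
  assumes const: "\<And>c. P (fa_const c)"
    and var: "\<And>i j p. j - i = 1 \<or> j - i = 2 \<Longrightarrow> P p \<Longrightarrow> P (fa_var i j * p)"
    and add: "\<And>p r. P p \<Longrightarrow> P r \<Longrightarrow> P (p + r)"
  shows "P (p :: 'f::field free_alg)"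
proof (rule free_alg_induct_single[where P = P])
  fix w and c :: 'f
  obtain gs where w: "w = Word gs" by (cases w)
  have "P (Poly_Mapping.single (Word gs) c)"
  proof (induction gs)
    case Nil
    then show ?case using const[of c] by (simp add: fa_const_def zero_gen_word_def)
  next
    case (Cons g gs)
    obtain i j where ij: "Rep_std_gen g = (i, j)" by fastforce
    have "j - i = 1 \<or> j - i = 2" using Rep_std_gen[of g] ij by simp
    from var[OF this Cons] show ?case
      by (simp add: fa_var_def mult_single flip: ij) (simp add: Rep_std_gen_inverse)
  qed
  then show "P (Poly_Mapping.single w c)" using w by simp
qed (rule add)

fun word_eval :: "(4 \<Rightarrow> 4 \<Rightarrow> 'f::field lin) \<Rightarrow> gen_word \<Rightarrow> 'f lin" where
  "word_eval X (Word gs) = foldr (\<lambda>g h. (case Rep_std_gen g of (i, j) \<Rightarrow> X i j) * h) gs 1"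

definition free_eval :: "(4 \<Rightarrow> 4 \<Rightarrow> 'f::field lin) \<Rightarrow> 'f free_alg \<Rightarrow> 'f lin" where
  "free_eval X p = (\<Sum>w\<in>Poly_Mapping.keys p. scalar (Poly_Mapping.lookup p w) * word_eval X w)"

lemma word_eval_plus: "word_eval X (u + v) = word_eval X u * word_eval X v"
proof (cases u; cases v)
  fix gs hs assume uv: "u = Word gs" "v = Word hs"
  show ?thesis unfolding uv by (induction gs) (simp_all add: mult.assoc)
qed

lemma free_eval_single: "free_eval X (Poly_Mapping.single w c) = scalar c * word_eval X w"
  by (cases "c = 0") (simp_all add: free_eval_def scalar_simps)

lemma free_eval_superset:
  assumes "finite A" "Poly_Mapping.keys p \<subseteq> A"
  shows "free_eval X p = (\<Sum>w\<in>A. scalar (Poly_Mapping.lookup p w) * word_eval X w)"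
  unfolding free_eval_def
  by (rule sum.mono_neutral_left) (use assms in \<open>auto simp: in_keys_iff scalar_simps\<close>)

lemma free_eval_add: "free_eval X (p + r) = free_eval X p + free_eval X r"
proof -
  let ?A = "Poly_Mapping.keys p \<union> Poly_Mapping.keys r"
  have "Poly_Mapping.keys (p + r) \<subseteq> ?A" by (rule Poly_Mapping.keys_add)
  then show ?thesis
    using free_eval_superset[of ?A "p + r" X] free_eval_superset[of ?A p X] free_eval_superset[of ?A r X]
    by (simp add: lookup_add scalar_simps distrib_right sum.distrib)
qed

lemma free_eval_mult: "free_eval X (p * r) = free_eval X p * free_eval X r"
proof (induction p rule: free_alg_induct_single)
  case (single w c)
  show ?case
  proof (induction r rule: free_alg_induct_single)
    case (single w' c')
    have "free_eval X (Poly_Mapping.single w c * Poly_Mapping.single w' c')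
        = scalar c * (scalar c' * word_eval X w) * word_eval X w'"
      by (simp add: mult_single free_eval_single word_eval_plus scalar_simps mult.assoc)
    also have "scalar c' * word_eval X w = word_eval X w * scalar c'"
      by (rule scalar_central[symmetric])
    finally show ?case by (simp add: free_eval_single mult.assoc)
  qed (simp add: distrib_left free_eval_add)
qed (simp add: distrib_right free_eval_add)

lemma free_eval_zero: "free_eval X 0 = 0"
  by (simp add: free_eval_def)

lemma free_eval_uminus: "free_eval X (- p) = - free_eval X p"
proof -
  have "free_eval X p + free_eval X (- p) = free_eval X 0"
    by (simp flip: free_eval_add)
  then show ?thesis by (simp add: free_eval_def eq_neg_iff_add_eq_0 add.commute)
qed

lemma free_eval_diff: "free_eval X (p - r) = free_eval X p - free_eval X r"
  using free_eval_add[of X p "- r"] by (simp add: free_eval_uminus)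

lemma free_eval_const: "free_eval X (fa_const c) = scalar c"
  by (simp add: fa_const_def free_eval_single zero_gen_word_def)

lemma free_eval_one: "free_eval X 1 = 1"
  using free_eval_const[of X 1] by (simp add: fa_const_def scalar_simps)

lemma free_eval_power: "free_eval X (p ^ n) = free_eval X p ^ n"
  by (induction n) (simp_all add: free_eval_one free_eval_mult)

lemma free_eval_var:
  assumes "j - i = 1 \<or> j - i = 2"
  shows "free_eval X (fa_var i j) = X i j"
  using assms by (simp add: fa_var_def free_eval_single scalar_simps Abs_std_gen_inverse)

lemmas free_eval_simps = free_eval_zero free_eval_add free_eval_diff free_eval_uminus free_eval_mult
  free_eval_const free_eval_one free_eval_power

section \<open>The quotient\<close>

lemma ring_free_ring: "ring (free_ring :: 'f::field free_alg ring)"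
proof -
  have "\<exists>y. y + x = 0" for x :: "'f free_alg" by (rule exI[of _ "- x"]) simp
  then show ?thesis
    by unfold_locales
      (auto simp: free_ring_def algebra_simps Units_def intro: exI[of _ "- x" for x])
qed

lemma relator_ideal_ideal: "ideal (relator_ideal q) free_ring"
  unfolding relator_ideal_def
  by (rule ring.genideal_ideal[OF ring_free_ring]) (simp add: free_ring_def)

lemma box_proj_hom: "box_proj q \<in> Ring.ring_hom free_ring (boxtimes q)"
  using ideal.rcos_ring_hom[OF relator_ideal_ideal]
  by (simp add: box_proj_def[abs_def] boxtimes_def)

lemma box_proj_simps:
  "box_proj q p \<in> carrier (boxtimes q)"
  "box_proj q (p + r) = box_proj q p \<oplus>\<^bsub>boxtimes q\<^esub> box_proj q r"
  "box_proj q (p * r) = box_proj q p \<otimes>\<^bsub>boxtimes q\<^esub> box_proj q r"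
  "box_proj q 1 = \<one>\<^bsub>boxtimes q\<^esub>"
  using box_proj_hom[of q, unfolded Ring.ring_hom_def] by (auto simp: free_ring_def Pi_def)

lemma boxtimes_carrierE:
  assumes "a \<in> carrier (boxtimes q)"
  obtains p where "a = box_proj q p"
  using assms by (auto simp: boxtimes_def FactRing_def A_RCOSETS_def' box_proj_def)

lemma box_proj_self: "p \<in> box_proj q p"
proof -
  interpret I: ideal "relator_ideal q" free_ring by (rule relator_ideal_ideal)
  show ?thesis unfolding box_proj_def by (rule I.a_rcos_self) (simp add: free_ring_def)
qed

lemma box_proj_member: "r \<in> box_proj q p \<Longrightarrow> box_proj q r = box_proj q p"
proof -
  interpret I: ideal "relator_ideal q" free_ring by (rule relator_ideal_ideal)
  assume "r \<in> box_proj q p"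
  then show ?thesis
    using I.a_repr_independence'[of r p] by (simp add: box_proj_def free_ring_def)
qed

text \<open>The module \<open>Vd\<close> acts through a representative selected by the choice operator; this identifies its
  class.\<close>

lemma box_proj_rep: "box_proj q (SOME r. r \<in> box_proj q p) = box_proj q p"
  by (rule box_proj_member, rule someI, rule box_proj_self)

lemma box_proj_eq_ideal:
  assumes "box_proj q r = box_proj q p"
  shows "r - p \<in> relator_ideal q"
proof -
  interpret I: ideal "relator_ideal q" free_ring by (rule relator_ideal_ideal)
  have "r \<in> box_proj q p" using assms box_proj_self by metis
  then obtain h where "h \<in> relator_ideal q" "r = h + p"
    by (auto simp: box_proj_def a_r_coset_def' free_ring_def)
  then show ?thesis by simp
qed

lemma box_proj_relator:
  assumes "r \<in> relators q"
  shows "box_proj q r = box_proj q 0"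
proof -
  interpret I: ideal "relator_ideal q" free_ring by (rule relator_ideal_ideal)
  have "r \<in> relator_ideal q"
    using ring.genideal_self[OF ring_free_ring] assms
    by (auto simp: relator_ideal_def free_ring_def)
  then have "r \<in> box_proj q 0" by (auto simp: box_proj_def a_r_coset_def' free_ring_def)
  then show ?thesis by (rule box_proj_member)
qed

text \<open>The kernel of an evaluation is a two-sided ideal.\<close>

lemma free_eval_ideal:
  assumes "\<And>r. r \<in> relators q \<Longrightarrow> free_eval X r = 0" and "p \<in> relator_ideal q"
  shows "free_eval X p = 0"
proof -
  let ?K = "{p. free_eval X p = 0}"
  interpret R: ring "free_ring :: 'a free_alg ring" by (rule ring_free_ring)
  have "ideal ?K free_ring"
  proof (rule idealI[OF ring_free_ring])
    show "subgroup ?K (add_monoid free_ring)"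
    proof
      fix p assume "p \<in> ?K"
      have "inv\<^bsub>add_monoid free_ring\<^esub> p = - p"
        by (rule R.minus_equality[unfolded a_inv_def]) (simp_all add: free_ring_def)
      then show "inv\<^bsub>add_monoid free_ring\<^esub> p \<in> ?K"
        using \<open>p \<in> ?K\<close> by (simp add: free_eval_simps)
    qed (auto simp: free_ring_def free_eval_simps)
  qed (auto simp: free_ring_def free_eval_simps)
  then have "relator_ideal q \<subseteq> ?K"
    unfolding relator_ideal_def
    by (rule ring.genideal_minimal[OF ring_free_ring]) (use assms(1) in auto)
  then show ?thesis using assms(2) by auto
qed

section \<open>The modules $\mathbf V_d(t)$\<close>

lemma app_sum: "app (sum f A) a = (\<Sum>x\<in>A. app (f x) a)"
  by (induction A rule: infinite_finite_induct) (simp_all add: app_simps)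

text \<open>On sequences supported on the block, extending the matrices by the identity makes no difference.\<close>

lemma free_op_eq:
  assumes "\<forall>i>d. v i = 0"
  shows "free_op d q t p v = app (free_eval (\<lambda>i j. block_op d (gen_mat d q t i j)) p) v"
proof -
  let ?T = "\<lambda>i j. block_op d (gen_mat d q t i j)"
  have "word_op d q t (Word gs) v = app (word_eval ?T (Word gs)) v \<and> (\<forall>i>d. word_op d q t (Word gs) v i = 0)" for gs
  proof (induction gs)
    case (Cons g gs)
    obtain i j where g: "Rep_std_gen g = (i, j)" by fastforce
    have "app (block_op d M) w = mat_op d M w" if "\<forall>i>d. w i = 0" for M :: "'a mat" and w
      by (rule ext) (use that in \<open>auto simp: app_block_op mat_op_def\<close>)
    then show ?case using Cons g by (auto simp: app_simps mat_op_def)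
  qed (use assms in \<open>simp_all add: app_simps\<close>)
  then have "word_op d q t w v = app (word_eval ?T w) v" for w by (cases w) simp
  then show ?thesis
    by (simp add: free_op_def free_eval_def app_sum app_simps app_scalar)
qed

context nonroot
begin

lemma q_diff: "q - inverse q \<noteq> 0"
proof
  assume "q - inverse q = 0"
  then have "q ^ 2 = 1" using q0 by (simp add: field_simps power2_eq_square)
  then show False using nonroot[of 2] by simp
qed

lemma qnum_3: "qnum q 3 = q * q + 1 + inverse q * inverse q"
proof -
  have "q powi 3 - q powi (- 3) = (q * q + 1 + inverse q * inverse q) * (q - inverse q)"
    using q0 by (simp add: power_int_minus power3_eq_cube) (simp add: field_simps)
  then show ?thesis using q_diff by (simp add: qnum_def)
qed

lemma free_eval_relator:
  assumes "admissible t" and "r \<in> relators q"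
  shows "free_eval (gen_op t) r = 0"
  using assms(2)
proof cases
  case (inv j i)
  have "i - j = 2" using inv(2) index_diff(2) by metis
  then show ?thesis
    using inv gen_op_inv[OF assms(1)] by (simp add: free_eval_simps free_eval_var)
next
  case (weyl j i k)
  have "weyl (gen_op t i j) (gen_op t j k)" using gen_op_weyl[OF assms(1) weyl(2)] .
  then have "scalar (1 / (q - inverse q)) * (scalar q * gen_op t i j * gen_op t j k
      - scalar (inverse q) * gen_op t j k * gen_op t i j) = scalar (1 / (q - inverse q) * (q - inverse q))"
    by (simp only: weyl_def scalar_simps)
  moreover have "j - i = 1 \<or> j - i = 2" "k - j = 1 \<or> k - j = 2" using weyl(2) by auto
  ultimately show ?thesis
    using q_diff by (simp add: weyl(1) free_eval_simps free_eval_var scalar_simps)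
next
  case (serre j i k l)
  have "serre_form (gen_op t i j) (gen_op t k l) = 0"
    using gen_op_serre[OF assms(1) serre(2-4)] .
  then show ?thesis
    using serre by (simp add: free_eval_simps free_eval_var qnum_3 serre_form_def scalar_simps)
qed

lemma Vd_act:
  assumes "admissible t" and "v \<in> mod_space (Vd q d t)"
  shows "mod_act (Vd q d t) (box_proj q p) v = app (free_eval (gen_op t) p) v"
proof -
  define r where "r = (SOME r. r \<in> box_proj q p)"
  have "r - p \<in> relator_ideal q"
    unfolding r_def by (rule box_proj_eq_ideal[OF box_proj_rep])
  then have "free_eval (gen_op t) (r - p) = 0"
    using free_eval_ideal[of q "gen_op t"] free_eval_relator[OF assms(1)] by blast
  then have "free_eval (gen_op t) r = free_eval (gen_op t) p" by (simp add: free_eval_simps)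
  then show ?thesis
    using free_op_eq[of d v q t r] assms(2) by (simp add: Vd_def flip: r_def)
qed

lemma free_eval_gen_op_closed:
  assumes "\<forall>i>d. v i = 0"
  shows "\<forall>i>d. app (free_eval (gen_op t) p) v i = 0"
  using assms
proof (induction p arbitrary: v rule: free_alg_induct)
  case (var i j p)
  then show ?case by (auto simp: free_eval_simps free_eval_var app_simps app_block_op)
qed (auto simp: free_eval_simps app_simps app_scalar fun_scale_def)

theorem Vd_module:
  assumes "admissible t"
  shows "boxtimes_module q (Vd q d t)"
proof -
  let ?V = "Vd q d t" and ?T = "free_eval (gen_op t)"
  have vs: "vector_space (fun_scale :: 'f \<Rightarrow> _)"
    by unfold_locales (auto simp: fun_scale_def fun_eq_iff algebra_simps)
  then interpret vector_space "fun_scale :: 'f \<Rightarrow> (nat \<Rightarrow> 'f) \<Rightarrow> _" .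
  have S: "v \<in> mod_space ?V \<longleftrightarrow> (\<forall>i>d. v i = 0)" for v by (simp add: Vd_def)
  note act = Vd_act[OF assms]
  have act': "mod_act ?V (box_proj q p) v = app (?T p) v" if "\<forall>i>d. v i = 0" for p v
    using act[of v p] that S by simp
  show ?thesis
    unfolding boxtimes_module_def
  proof (intro conjI ballI allI)
    show "vector_space (mod_scale ?V)" using vs by (simp add: Vd_def)
    show "module.subspace (mod_scale ?V) (mod_space ?V)"
      by (auto simp: Vd_def subspace_def fun_scale_def)
  next
    fix a v assume a: "a \<in> carrier (boxtimes q)" and v: "v \<in> mod_space ?V"
    obtain p where p: "a = box_proj q p" using a by (rule boxtimes_carrierE)
    show "mod_act ?V a v \<in> mod_space ?V"
      using free_eval_gen_op_closed[of v t p] v by (simp add: p act S)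
    fix w assume w: "w \<in> mod_space ?V"
    with v have "v + w \<in> mod_space ?V" by (simp add: S)
    then show "mod_act ?V a (v + w) = mod_act ?V a v + mod_act ?V a w"
      using v w by (simp add: p act app_add)
  next
    fix a b v assume a: "a \<in> carrier (boxtimes q)" and b: "b \<in> carrier (boxtimes q)"
      and v: "v \<in> mod_space ?V"
    obtain p where p: "a = box_proj q p" using a by (rule boxtimes_carrierE)
    obtain r where r: "b = box_proj q r" using b by (rule boxtimes_carrierE)
    show "mod_act ?V (a \<oplus>\<^bsub>boxtimes q\<^esub> b) v = mod_act ?V a v + mod_act ?V b v"
      unfolding p r box_proj_simps(2)[symmetric] using v by (simp add: act free_eval_simps app_simps)
    have "app (?T r) v \<in> mod_space ?V" using free_eval_gen_op_closed[of v t r] v by (simp add: S)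
    then show "mod_act ?V (a \<otimes>\<^bsub>boxtimes q\<^esub> b) v = mod_act ?V a (mod_act ?V b v)"
      unfolding p r box_proj_simps(3)[symmetric] using v by (simp add: act free_eval_simps app_simps)
  next
    fix v assume v: "v \<in> mod_space ?V"
    show "mod_act ?V \<one>\<^bsub>boxtimes q\<^esub> v = v"
      unfolding box_proj_simps(4)[symmetric] using v by (simp add: act free_eval_simps app_simps)
    fix c show "mod_act ?V (box_proj q (fa_const c)) v = mod_scale ?V c v"
      using v by (simp add: act free_eval_simps app_scalar) (simp add: Vd_def)
  qed
qed

end

section \<open>Representations in coordinates\<close>

definition coord_space :: "nat \<Rightarrow> (nat \<Rightarrow> 'f::field) set" where
  "coord_space d = {a. \<forall>i>d. a i = 0}"

definition unit_coord :: "nat \<Rightarrow> nat \<Rightarrow> 'f::field" where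
  "unit_coord n = (\<lambda>i. if i = n then 1 else 0)"

lemma unit_coord_apply: "unit_coord n i = (if i = n then 1 else 0)"
  by (simp add: unit_coord_def)

lemma unit_coord_in [simp]: "n \<le> d \<Longrightarrow> unit_coord n \<in> coord_space d"
  by (auto simp: coord_space_def unit_coord_def)

lemma coord_space_closed [simp]:
  "0 \<in> coord_space d"
  "a \<in> coord_space d \<Longrightarrow> b \<in> coord_space d \<Longrightarrow> a + b \<in> coord_space d"
  "a \<in> coord_space d \<Longrightarrow> fun_scale c a \<in> coord_space d"
  by (auto simp: coord_space_def fun_scale_def)

lemma coord_spaceI: "(\<And>i. i > d \<Longrightarrow> a i = 0) \<Longrightarrow> a \<in> coord_space d"
  by (simp add: coord_space_def)

lemma coord_space_beyond: "a \<in> coord_space d \<Longrightarrow> i > d \<Longrightarrow> a i = 0"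
  by (simp add: coord_space_def)

lemma coord_eqI:
  assumes "a \<in> coord_space d" "b \<in> coord_space d" "\<And>i. i \<le> d \<Longrightarrow> a i = b i"
  shows "a = b"
proof
  fix i show "a i = b i" using assms by (cases "i \<le> d") (auto simp: coord_space_def)
qed

definition coord_linear :: "nat \<Rightarrow> ((nat \<Rightarrow> 'f::field) \<Rightarrow> nat \<Rightarrow> 'f) \<Rightarrow> bool" where
  "coord_linear d h \<longleftrightarrow> (\<forall>a\<in>coord_space d. h a \<in> coord_space d \<and> (\<forall>c. h (fun_scale c a) = fun_scale c (h a)) \<and>
     (\<forall>b\<in>coord_space d. h (a + b) = h a + h b))"

lemma coord_linearD:
  assumes "coord_linear d h" and "a \<in> coord_space d"
  shows "h a \<in> coord_space d" "h (fun_scale c a) = fun_scale c (h a)"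
    "b \<in> coord_space d \<Longrightarrow> h (a + b) = h a + h b"
  using assms by (simp_all only: coord_linear_def)

lemma sum_apply: "(\<Sum>x\<in>A. f x) i = (\<Sum>x\<in>A. f x i)"
  by (induction A rule: infinite_finite_induct) simp_all

lemma coord_linear_mat_op:
  assumes h: "coord_linear d h" and a: "a \<in> coord_space d"
  shows "h a = mat_op d (mat (d + 1) (d + 1) (\<lambda>(i, n). h (unit_coord n) i)) a"
proof (rule coord_eqI[of _ d])
  show "h a \<in> coord_space d" using assms by (simp add: coord_linear_def)
  show "mat_op d (mat (d + 1) (d + 1) (\<lambda>(i, n). h (unit_coord n) i)) a \<in> coord_space d"
    by (auto simp: coord_space_def mat_op_def)
  have sum: "(\<Sum>n\<in>A. fun_scale (a n) (unit_coord n)) \<in> coord_space d \<and>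
      h (\<Sum>n\<in>A. fun_scale (a n) (unit_coord n)) = (\<Sum>n\<in>A. fun_scale (a n) (h (unit_coord n)))"
    if "finite A" "A \<subseteq> {..d}" for A
    using that
  proof (induction A)
    case empty
    have "h (fun_scale 0 0) = fun_scale 0 (h 0)" using h by (simp add: coord_linear_def)
    then show ?case by (simp add: fun_scale_def zero_fun_def[symmetric])
  next
    case (insert n A)
    let ?s = "\<Sum>n\<in>A. fun_scale (a n) (unit_coord n)" and ?x = "fun_scale (a n) (unit_coord n)"
    have in_space: "?x \<in> coord_space d" "?s \<in> coord_space d" using insert by auto
    have "h (?x + ?s) = h ?x + h ?s" using h in_space by (simp only: coord_linear_def)
    also have "h ?x = fun_scale (a n) (h (unit_coord n))"
      using h insert by (auto simp: coord_linear_def)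
    also have "h ?s = (\<Sum>n\<in>A. fun_scale (a n) (h (unit_coord n)))"
      using insert by blast
    finally show ?case
      unfolding sum.insert[OF insert.hyps] using coord_space_closed(2)[OF in_space] by (rule conjI[rotated])
  qed
  have "a = (\<Sum>n\<le>d. fun_scale (a n) (unit_coord n))"
  proof
    fix i
    have "(\<Sum>n\<le>d. fun_scale (a n) (unit_coord n)) i = (\<Sum>n\<le>d. if n = i then a n else 0)"
      unfolding sum_apply by (rule sum.cong) (auto simp: fun_scale_def unit_coord_apply)
    then show "a i = (\<Sum>n\<le>d. fun_scale (a n) (unit_coord n)) i"
      using a by (auto simp: coord_space_def)
  qed
  then have "h a = (\<Sum>n\<le>d. fun_scale (a n) (h (unit_coord n)))"
    using sum[of "{..d}"] by simp
  then show "h a i = mat_op d (mat (d + 1) (d + 1) (\<lambda>(i, n). h (unit_coord n) i)) a i" if "i \<le> d" for i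
    using that by (simp add: sum_apply mat_op_def fun_scale_def mult.commute)
qed

lemma coord_linear_eqI:
  assumes "coord_linear d h" "coord_linear d h'" "a \<in> coord_space d"
    and "\<And>n. n \<le> d \<Longrightarrow> h (unit_coord n) = h' (unit_coord n)"
  shows "h a = h' a"
  using coord_linear_mat_op[OF assms(1,3)] coord_linear_mat_op[OF assms(2,3)] assms(4)
  by (simp add: mat_op_def fun_eq_iff)

context nonroot
begin

text \<open>For a module that is only known abstractly, its operators are controlled on the sequences supported
  on \<open>{..d}\<close> and nowhere else; these are the corresponding local versions of the notions above.\<close>

definition upper_on :: "((nat \<Rightarrow> 'f) \<Rightarrow> nat \<Rightarrow> 'f) \<Rightarrow> (nat \<Rightarrow> 'f) \<Rightarrow> bool" where
  "upper_on h u \<longleftrightarrow> (\<forall>a\<in>coord_space d. \<forall>i\<le>d. h a i = kap i * a i + u i * a (Suc i))"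

definition lower_on :: "((nat \<Rightarrow> 'f) \<Rightarrow> nat \<Rightarrow> 'f) \<Rightarrow> (nat \<Rightarrow> 'f) \<Rightarrow> bool" where
  "lower_on h v \<longleftrightarrow> v 0 = 0 \<and> (\<forall>a\<in>coord_space d. \<forall>i\<le>d. h a i = kap i * a i + v i * a (i - 1))"

definition diag_on :: "((nat \<Rightarrow> 'f) \<Rightarrow> nat \<Rightarrow> 'f) \<Rightarrow> bool" where
  "diag_on k \<longleftrightarrow> (\<forall>a\<in>coord_space d. \<forall>i\<le>d. k a i = inverse (kap i) * a i)"

definition weyl_on :: "((nat \<Rightarrow> 'f) \<Rightarrow> nat \<Rightarrow> 'f) \<Rightarrow> ((nat \<Rightarrow> 'f) \<Rightarrow> nat \<Rightarrow> 'f) \<Rightarrow> bool" where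
  "weyl_on x y \<longleftrightarrow> (\<forall>a\<in>coord_space d. \<forall>i.
     q * x (y a) i - inverse q * y (x a) i = (q - inverse q) * a i)"

lemma diag_on_unit:
  assumes "coord_linear d k" "diag_on k" "n \<le> d"
  shows "k (unit_coord n) = fun_scale (inverse (kap n)) (unit_coord n)"
proof (rule coord_eqI[of _ d])
  show "k (unit_coord n) \<in> coord_space d"
    using assms(3) by (intro coord_linearD(1)[OF assms(1)]) simp
  show "fun_scale (inverse (kap n)) (unit_coord n) \<in> coord_space d" using assms(3) by simp
  fix i assume "i \<le> d"
  then have "k (unit_coord n) i = inverse (kap i) * unit_coord n i"
    using assms(2,3) by (simp add: diag_on_def)
  then show "k (unit_coord n) i = fun_scale (inverse (kap n)) (unit_coord n) i"
    by (simp add: fun_scale_def unit_coord_apply)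
qed

text \<open>If \<open>k\<close> is diagonal, the $q$-Weyl relation decouples into one scalar equation for each matrix entry.
  As the \<open>kap\<close> are distinct and \<open>kap (Suc r) = q\<^sup>2 * kap r\<close>, an entry can be nonzero only on the
  diagonal, where its value is forced, and next to it on one side.\<close>

lemma weyl_scalar:
  assumes "k \<noteq> 0" "l \<noteq> 0" and "q * (inverse k * x) - inverse q * (inverse l * x) = (q - inverse q) * e"
  shows "x * (q\<^sup>2 * l - k) = (q\<^sup>2 - 1) * (k * l * e)"
proof -
  have "x * (q\<^sup>2 * l - k) = q * k * l * (q * (inverse k * x) - inverse q * (inverse l * x))"
    using assms(1,2) q0 by (simp add: field_simps power2_eq_square)
  also have "\<dots> = (q\<^sup>2 - 1) * (k * l * e)"
    unfolding assms(3) using q0 by (simp add: field_simps power2_eq_square)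
  finally show ?thesis .
qed

lemma weyl_diag_entry_right:
  assumes "coord_linear d h" "coord_linear d k" "diag_on k" "weyl_on h k" "n \<le> d" "i \<le> d"
  shows "h (unit_coord n) i * (kap (Suc i) - kap n) = (if i = n then (q\<^sup>2 - 1) * kap i * kap i else 0)"
proof -
  have 1: "h (k (unit_coord n)) i = inverse (kap n) * h (unit_coord n) i"
    using assms by (simp add: diag_on_unit coord_linear_def fun_scale_def)
  have 2: "k (h (unit_coord n)) i = inverse (kap i) * h (unit_coord n) i"
    using assms by (simp add: diag_on_def coord_linear_def)
  have "q * h (k (unit_coord n)) i - inverse q * k (h (unit_coord n)) i = (q - inverse q) * unit_coord n i"
    using assms(4,5) by (simp add: weyl_on_def)
  from weyl_scalar[OF _ _ this[unfolded 1 2]] show ?thesis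
    by (auto simp: unit_coord_apply kap_Suc)
qed

lemma weyl_diag_entry_left:
  assumes "coord_linear d h" "coord_linear d k" "diag_on k" "weyl_on k h" "n \<le> d" "i \<le> d"
  shows "h (unit_coord n) i * (kap (Suc n) - kap i) = (if i = n then (q\<^sup>2 - 1) * kap i * kap i else 0)"
proof -
  have 1: "h (k (unit_coord n)) i = inverse (kap n) * h (unit_coord n) i"
    using assms by (simp add: diag_on_unit coord_linear_def fun_scale_def)
  have 2: "k (h (unit_coord n)) i = inverse (kap i) * h (unit_coord n) i"
    using assms by (simp add: diag_on_def coord_linear_def)
  have "q * k (h (unit_coord n)) i - inverse q * h (k (unit_coord n)) i = (q - inverse q) * unit_coord n i"
    using assms(4,5) by (simp add: weyl_on_def)
  from weyl_scalar[OF _ _ this[unfolded 1 2]] show ?thesis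
    by (auto simp: unit_coord_apply kap_Suc)
qed

lemma diag_entry:
  assumes "x * (kap (Suc n) - kap n) = (q\<^sup>2 - 1) * kap n * kap n"
  shows "x = kap n"
proof -
  have "(x - kap n) * (kap (Suc n) - kap n) = 0"
    using assms by (simp add: algebra_simps kap_Suc)
  then show ?thesis by (simp add: kap_inj)
qed

lemma weyl_upper_on:
  assumes h: "coord_linear d h" "coord_linear d k" "diag_on k" "weyl_on h k"
  shows "\<exists>u. upper_on h u"
proof -
  let ?M = "mat (d + 1) (d + 1) (\<lambda>(i, n). h (unit_coord n) i)"
  note e = weyl_diag_entry_right[OF h]
  have off: "h (unit_coord n) i = 0" if "n \<le> d" "i \<le> d" "n \<noteq> i" "n \<noteq> Suc i" for n i
    using e[OF that(1,2)] that by (auto simp: kap_inj)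
  have diag: "h (unit_coord i) i = kap i" if "i \<le> d" for i
    using e[OF that that] by (simp add: diag_entry)
  have "upper_on h (\<lambda>i. h (unit_coord (Suc i)) i)"
    unfolding upper_on_def
  proof (intro ballI allI impI)
    fix a :: "nat \<Rightarrow> 'f" and i assume a: "a \<in> coord_space d" and i: "i \<le> d"
    have "h a i = mat_op d ?M a i" using coord_linear_mat_op[OF h(1) a] by simp
    also have "\<dots> = (case i of 0 \<Rightarrow> 0 | Suc j \<Rightarrow> ?M $$ (i, j) * a j) + ?M $$ (i, i) * a i
      + (if i = d then 0 else ?M $$ (i, Suc i) * a (Suc i))"
      by (rule mat_op_banded) (use i off in auto)
    also have "(case i of 0 \<Rightarrow> 0 | Suc j \<Rightarrow> ?M $$ (i, j) * a j) = 0"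
      using off i by (auto split: nat.split)
    finally show "h a i = kap i * a i + h (unit_coord (Suc i)) i * a (Suc i)"
      using i a by (auto simp: diag coord_space_beyond)
  qed
  then show ?thesis by blast
qed

lemma weyl_lower_on:
  assumes h: "coord_linear d h" "coord_linear d k" "diag_on k" "weyl_on k h"
  shows "\<exists>v. lower_on h v"
proof -
  let ?M = "mat (d + 1) (d + 1) (\<lambda>(i, n). h (unit_coord n) i)"
  note e = weyl_diag_entry_left[OF h]
  have off: "h (unit_coord n) i = 0" if "n \<le> d" "i \<le> d" "n \<noteq> i" "Suc n \<noteq> i" for n i
    using e[OF that(1,2)] that by (auto simp: kap_inj)
  have diag: "h (unit_coord i) i = kap i" if "i \<le> d" for i
    using e[OF that that] by (simp add: diag_entry)
  have "lower_on h (\<lambda>i. case i of 0 \<Rightarrow> 0 | Suc j \<Rightarrow> h (unit_coord j) i)"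
    unfolding lower_on_def
  proof (intro conjI ballI allI impI)
    fix a :: "nat \<Rightarrow> 'f" and i assume a: "a \<in> coord_space d" and i: "i \<le> d"
    have "h a i = mat_op d ?M a i" using coord_linear_mat_op[OF h(1) a] by simp
    also have "\<dots> = (case i of 0 \<Rightarrow> 0 | Suc j \<Rightarrow> ?M $$ (i, j) * a j) + ?M $$ (i, i) * a i
      + (if i = d then 0 else ?M $$ (i, Suc i) * a (Suc i))"
      by (rule mat_op_banded) (use i off in auto)
    also have "(if i = d then 0 else ?M $$ (i, Suc i) * a (Suc i)) = 0"
      using off i by auto
    finally show "h a i = kap i * a i + (case i of 0 \<Rightarrow> 0 | Suc j \<Rightarrow> h (unit_coord j) i) * a (i - 1)"
      using i a diag by (cases i) auto
  qed simp
  then show ?thesis by blast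
qed

lemma edge_product_nz: "i < d \<Longrightarrow> edge_product i \<noteq> 0"
  using kap_inj[of d i] kap_inj[of 0 "Suc i"] by (auto simp: edge_product_def kap_0 kap_d kap_Suc)

lemma edge_product_Suc: "edge_product (Suc i) = q\<^sup>2 * edge_product i + (q\<^sup>2 - 1) * ((kap (Suc i))\<^sup>2 - 1)"
proof -
  have "(D - q\<^sup>2 * k) * (D' - q\<^sup>2 * (q\<^sup>2 * k)) =
      q\<^sup>2 * ((D - k) * (D' - q\<^sup>2 * k)) + (q\<^sup>2 - 1) * ((q\<^sup>2 * k)\<^sup>2 - 1)"
    if D: "D * D' = 1" for D D' k
  proof -
    have "D * (D' * x) = x" for x using D by (simp add: mult.assoc[symmetric])
    then show ?thesis using D by (simp add: algebra_simps power2_eq_square)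
  qed
  then show ?thesis unfolding edge_product_def kap_Suc using q0 by simp
qed

lemma edge_product_0: "edge_product 0 = (q\<^sup>2 - 1) * ((kap 0)\<^sup>2 - 1)"
proof -
  have "(D - k) * (k - q\<^sup>2 * k) = (q\<^sup>2 - 1) * (k\<^sup>2 - 1)"
    if D: "D * k = 1" for D k
  proof -
    have "D * (k * x) = x" for x using D by (simp add: mult.assoc[symmetric])
    then show ?thesis using D by (simp add: algebra_simps power2_eq_square)
  qed
  then show ?thesis using q0 by (simp add: edge_product_def kap_0)
qed

text \<open>The diagonal entries of the $q$-Weyl relation give a first order recursion for the products of
  opposite entries, starting from zero at the corner. The same values arise for every such pair.\<close>

lemma lower_upper_product:
  assumes h: "coord_linear d h" "lower_on h v" and z: "coord_linear d z" "upper_on z u"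
    and w: "weyl_on h z" and "i < d"
  shows "u i * v (Suc i) = edge_product i"
proof -
  have step: "u i * v (Suc i) = (q\<^sup>2 - 1) * ((kap i)\<^sup>2 - 1) + q\<^sup>2 * (if i = 0 then 0 else u (i - 1) * v i)"
    if i: "i < d" for i
  proof -
    let ?a = "unit_coord i"
    have a: "?a \<in> coord_space d" using i by simp
    then have hz: "h ?a \<in> coord_space d" "z ?a \<in> coord_space d"
      using h z by (auto simp: coord_linear_def)
    have "h (z ?a) i = kap i * z ?a i + v i * z ?a (i - 1)"
      using h(2) hz i by (simp add: lower_on_def)
    also have "z ?a i = kap i" using z(2) a i by (simp add: upper_on_def unit_coord_apply)
    also have "v i * z ?a (i - 1) = (if i = 0 then 0 else v i * u (i - 1))"
      using z(2) h(2) a i by (cases i) (auto simp: upper_on_def lower_on_def unit_coord_apply)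
    finally have 1: "h (z ?a) i = kap i * kap i + (if i = 0 then 0 else v i * u (i - 1))" .
    have "z (h ?a) i = kap i * h ?a i + u i * h ?a (Suc i)"
      using z(2) hz i by (simp add: upper_on_def)
    also have "h ?a i = kap i"
      using h(2) a i by (cases i) (auto simp: lower_on_def unit_coord_apply)
    also have "h ?a (Suc i) = v (Suc i)"
      using h(2) a i by (simp add: lower_on_def unit_coord_apply)
    finally have 2: "z (h ?a) i = kap i * kap i + u i * v (Suc i)" .
    have "q * h (z ?a) i - inverse q * z (h ?a) i = (q - inverse q) * ?a i"
      by (rule w[unfolded weyl_on_def, rule_format, OF a])
    then have "q * (q * h (z ?a) i - inverse q * z (h ?a) i) = q * (q - inverse q)"
      by (simp add: unit_coord_apply)
    moreover have "q * (q * x - inverse q * y) = q * q * x - y" for x y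
      using q0 by (simp add: field_simps)
    moreover have "q * (q - inverse q) = q * q - 1"
      using q0 by (simp add: field_simps)
    ultimately have "q * q * h (z ?a) i - z (h ?a) i = q * q - 1" by simp
    then show ?thesis unfolding 1 2
      by (auto simp: algebra_simps power2_eq_square)
  qed
  show ?thesis using \<open>i < d\<close>
  proof (induction i)
    case 0
    then show ?case using step[of 0] by (simp add: edge_product_0)
  next
    case (Suc i)
    then show ?case using step[of "Suc i"] by (simp add: edge_product_Suc)
  qed
qed

lemma weyl_onD:
  "weyl_on x y \<Longrightarrow> a \<in> coord_space d \<Longrightarrow> q * x (y a) i - inverse q * y (x a) i = (q - inverse q) * a i"
  unfolding weyl_on_def by blast

text \<open>A relation with the inverse of \<open>x\<close> is turned into one with \<open>x\<close> by multiplying with \<open>x\<close> on both sides.\<close>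

lemma weyl_on_inverse_right:
  assumes lin: "coord_linear d y" "coord_linear d x" "coord_linear d x'"
    and inv: "\<And>a. a \<in> coord_space d \<Longrightarrow> x (x' a) = a" "\<And>a. a \<in> coord_space d \<Longrightarrow> x' (x a) = a"
    and w: "weyl_on y x'" and a: "a \<in> coord_space d"
  shows "q * x (y a) i - inverse q * y (x a) i = (q - inverse q) * x (x a) i"
proof -
  note [simp] = coord_linearD(1)[OF lin(1)] coord_linearD(1)[OF lin(2)] coord_linearD(1)[OF lin(3)]
  have "fun_scale q (y a) + fun_scale (- inverse q) (x' (y (x a))) = fun_scale (q - inverse q) (x a)"
  proof
    fix i
    show "(fun_scale q (y a) + fun_scale (- inverse q) (x' (y (x a)))) i = fun_scale (q - inverse q) (x a) i"
      using weyl_onD[OF w, of "x a" i] a by (simp add: inv fun_scale_def)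
  qed
  then have "x (fun_scale q (y a) + fun_scale (- inverse q) (x' (y (x a)))) = x (fun_scale (q - inverse q) (x a))"
    by (rule arg_cong)
  moreover have "x (fun_scale q (y a) + fun_scale (- inverse q) (x' (y (x a))))
      = x (fun_scale q (y a)) + x (fun_scale (- inverse q) (x' (y (x a))))"
    by (rule coord_linearD(3)[OF lin(2)]) (use a in simp_all)
  moreover have "x (fun_scale q (y a)) = fun_scale q (x (y a))"
    by (rule coord_linearD(2)[OF lin(2)]) (use a in simp)
  moreover have "x (fun_scale (- inverse q) (x' (y (x a)))) = fun_scale (- inverse q) (x (x' (y (x a))))"
    by (rule coord_linearD(2)[OF lin(2)]) (use a in simp)
  moreover have "x (x' (y (x a))) = y (x a)" by (rule inv) (use a in simp)
  moreover have "x (fun_scale (q - inverse q) (x a)) = fun_scale (q - inverse q) (x (x a))"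
    by (rule coord_linearD(2)[OF lin(2)]) (use a in simp)
  ultimately have "fun_scale q (x (y a)) + fun_scale (- inverse q) (y (x a)) = fun_scale (q - inverse q) (x (x a))"
    by (simp only:)
  from fun_cong[OF this, of i] show ?thesis by (simp add: fun_scale_def)
qed

lemma weyl_on_inverse_left:
  assumes lin: "coord_linear d y" "coord_linear d x" "coord_linear d x'"
    and inv: "\<And>a. a \<in> coord_space d \<Longrightarrow> x (x' a) = a" "\<And>a. a \<in> coord_space d \<Longrightarrow> x' (x a) = a"
    and w: "weyl_on x' y" and a: "a \<in> coord_space d"
  shows "q * y (x a) i - inverse q * x (y a) i = (q - inverse q) * x (x a) i"
proof -
  note [simp] = coord_linearD(1)[OF lin(1)] coord_linearD(1)[OF lin(2)] coord_linearD(1)[OF lin(3)]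
  have "fun_scale q (x' (y (x a))) + fun_scale (- inverse q) (y a) = fun_scale (q - inverse q) (x a)"
  proof
    fix i
    show "(fun_scale q (x' (y (x a))) + fun_scale (- inverse q) (y a)) i = fun_scale (q - inverse q) (x a) i"
      using weyl_onD[OF w, of "x a" i] a by (simp add: inv fun_scale_def)
  qed
  then have "x (fun_scale q (x' (y (x a))) + fun_scale (- inverse q) (y a)) = x (fun_scale (q - inverse q) (x a))"
    by (rule arg_cong)
  moreover have "x (fun_scale q (x' (y (x a))) + fun_scale (- inverse q) (y a))
      = x (fun_scale q (x' (y (x a)))) + x (fun_scale (- inverse q) (y a))"
    by (rule coord_linearD(3)[OF lin(2)]) (use a in simp_all)
  moreover have "x (fun_scale (- inverse q) (y a)) = fun_scale (- inverse q) (x (y a))"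
    by (rule coord_linearD(2)[OF lin(2)]) (use a in simp)
  moreover have "x (fun_scale q (x' (y (x a)))) = fun_scale q (x (x' (y (x a))))"
    by (rule coord_linearD(2)[OF lin(2)]) (use a in simp)
  moreover have "x (x' (y (x a))) = y (x a)" by (rule inv) (use a in simp)
  moreover have "x (fun_scale (q - inverse q) (x a)) = fun_scale (q - inverse q) (x (x a))"
    by (rule coord_linearD(2)[OF lin(2)]) (use a in simp)
  ultimately have "fun_scale q (y (x a)) + fun_scale (- inverse q) (x (y a)) = fun_scale (q - inverse q) (x (x a))"
    by (simp only:)
  from fun_cong[OF this, of i] show ?thesis by (simp add: fun_scale_def)
qed

end
section \<open>Classification in coordinates\<close>

text \<open>The action of the $q$-tetrahedron algebra on a module, written in coordinates with
  respect to an eigenbasis of $x_{23}$.\<close>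

locale coord_rep = nonroot q d for q :: "'f::field" and d +
  fixes Y :: "4 \<Rightarrow> 4 \<Rightarrow> (nat \<Rightarrow> 'f) \<Rightarrow> nat \<Rightarrow> 'f"
  assumes lin: "coord_linear d (Y i j)"
    and inv: "j - i = 2 \<Longrightarrow> a \<in> coord_space d \<Longrightarrow> Y i j (Y j i a) = a"
    and weyl_Y: "(j - i, k - j) \<in> {(1, 1), (1, 2), (2, 1)} \<Longrightarrow> weyl_on (Y i j) (Y j k)"
    and diag: "diag_on (Y 2 3)"
begin

lemma Y_closed [simp]: "a \<in> coord_space d \<Longrightarrow> Y i j a \<in> coord_space d"
  by (rule coord_linearD(1)[OF lin])

lemma Y_weyls:
  "weyl_on (Y 0 1) (Y 1 2)" "weyl_on (Y 1 2) (Y 2 3)" "weyl_on (Y 2 3) (Y 3 0)"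
  "weyl_on (Y 1 2) (Y 2 0)" "weyl_on (Y 2 3) (Y 3 1)" "weyl_on (Y 3 0) (Y 0 2)"
  "weyl_on (Y 0 2) (Y 2 3)" "weyl_on (Y 2 0) (Y 0 1)" "weyl_on (Y 3 1) (Y 1 2)"
  by (rule weyl_Y; simp)+

lemma Y_inverse:
  assumes "a \<in> coord_space d"
  shows "Y 0 2 (Y 2 0 a) = a" "Y 2 0 (Y 0 2 a) = a" "Y 3 1 (Y 1 3 a) = a" "Y 1 3 (Y 3 1 a) = a"
  by (rule inv[OF _ assms]; simp)+

lemma Y_weyl_02:
  assumes "a \<in> coord_space d"
  shows "q * Y 0 2 (Y 1 2 a) i - inverse q * Y 1 2 (Y 0 2 a) i = (q - inverse q) * Y 0 2 (Y 0 2 a) i"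
    "q * Y 0 1 (Y 0 2 a) i - inverse q * Y 0 2 (Y 0 1 a) i = (q - inverse q) * Y 0 2 (Y 0 2 a) i"
  using weyl_on_inverse_right[OF lin lin lin Y_inverse(1,2) Y_weyls(4) assms]
    weyl_on_inverse_left[OF lin lin lin Y_inverse(1,2) Y_weyls(8) assms] by auto

end

context nonroot
begin

lemma coord_rep_gen_op:
  assumes "admissible t"
  shows "coord_rep q d (\<lambda>i j. app (gen_op t i j))"
proof
  show "coord_linear d (app (gen_op t i j))" for i j
    unfolding coord_linear_def
    by (auto simp: app_add app_scale app_block_op intro!: coord_spaceI dest: coord_space_beyond)
  show "app (gen_op t i j) (app (gen_op t j i) a) = a" if "j - i = 2" for i j :: 4 and a
    using gen_op_inv[OF assms that] by (metis app_simps(2,6))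
  show "weyl_on (app (gen_op t i j)) (app (gen_op t j k))"
    if "(j - i, k - j) \<in> {(1, 1), (1, 2), (2, 1)}" for i j k
    using gen_op_weyl[OF assms that] unfolding weyl_iff weyl_on_def by blast
  show "diag_on (app (gen_op t 2 3))"
    by (simp add: diag_on_def gen_op_23)
qed

lemma upper_on_eqI:
  assumes "coord_linear d h" "upper_on h u" "upper g w" "\<And>i. i < d \<Longrightarrow> u i = w i" "a \<in> coord_space d"
  shows "h a = app g a"
proof (rule coord_eqI[of _ d])
  show "h a \<in> coord_space d" by (rule coord_linearD(1)[OF assms(1,5)])
  show "app g a \<in> coord_space d"
    using assms(3,5) by (auto simp: upper_def intro!: coord_spaceI dest: coord_space_beyond)
  show "h a i = app g a i" if "i \<le> d" for i
    using assms that by (cases "i = d") (auto simp: upper_def upper_on_def coord_space_beyond)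
qed

lemma lower_on_eqI:
  assumes "coord_linear d h" "lower_on h u" "lower g w" "\<And>i. i < d \<Longrightarrow> u (Suc i) = w (Suc i)"
    and "a \<in> coord_space d"
  shows "h a = app g a"
proof (rule coord_eqI[of _ d])
  show "h a \<in> coord_space d" by (rule coord_linearD(1)[OF assms(1,5)])
  show "app g a \<in> coord_space d"
    using assms(3,5) by (auto simp: lower_def intro!: coord_spaceI dest: coord_space_beyond)
  show "h a i = app g a i" if "i \<le> d" for i
    using assms that by (cases i) (auto simp: lower_def lower_on_def)
qed

lemma upper_on_unit:
  assumes "coord_linear d z" "upper_on z u" "n \<le> d"
  shows "z (unit_coord n) = fun_scale (kap n) (unit_coord n)
    + (if n = 0 then 0 else fun_scale (u (n - 1)) (unit_coord (n - 1)))"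
proof (rule coord_eqI[of _ d])
  have n: "(unit_coord n :: nat \<Rightarrow> 'f) \<in> coord_space d" "(unit_coord (n - 1) :: nat \<Rightarrow> 'f) \<in> coord_space d"
    using assms(3) by auto
  show "z (unit_coord n) \<in> coord_space d" by (rule coord_linearD(1)[OF assms(1) n(1)])
  show "fun_scale (kap n) (unit_coord n) + (if n = 0 then 0 else fun_scale (u (n - 1)) (unit_coord (n - 1)))
      \<in> coord_space d"
    using n by (intro coord_space_closed) simp_all
  fix i assume "i \<le> d"
  then have "z (unit_coord n) i = kap i * unit_coord n i + u i * unit_coord n (Suc i)"
    using assms(2) n by (simp only: upper_on_def)
  then show "z (unit_coord n) i = (fun_scale (kap n) (unit_coord n)
      + (if n = 0 then 0 else fun_scale (u (n - 1)) (unit_coord (n - 1)))) i"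
    by (auto simp: unit_coord_apply fun_scale_def)
qed

text \<open>If \<open>A\<close> and \<open>A'\<close> satisfy the same relation with \<open>z\<close>, their difference maps eigenvectors of \<open>z\<close> for
  an eigenvalue to eigenvectors for \<open>q\<^sup>2\<close> times this eigenvalue. A unit vector behaves like an
  eigenvector once the difference vanishes on the preceding unit vectors.\<close>

lemma intertwining_defect:
  assumes A: "coord_linear d A" and A': "coord_linear d A'" and z: "coord_linear d z" "upper_on z u"
    and n: "n \<le> d" and i: "i \<le> d"
    and less: "\<And>m. m < n \<Longrightarrow> A (unit_coord m) = A' (unit_coord m)"
    and rel: "q * A (z (unit_coord n)) i - inverse q * z (A (unit_coord n)) i
      = q * A' (z (unit_coord n)) i - inverse q * z (A' (unit_coord n)) i"
  defines "B \<equiv> \<lambda>i. A (unit_coord n) i - A' (unit_coord n) i"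
  shows "kap (Suc n) * B i = kap i * B i + u i * B (Suc i)"
proof -
  let ?a = "unit_coord n :: nat \<Rightarrow> 'f"
  have a: "?a \<in> coord_space d" using n by simp
  have expand: "H (z ?a) i = kap n * H ?a i + (if n = 0 then 0 else u (n - 1) * H (unit_coord (n - 1)) i)"
    if H: "coord_linear d H" for H
  proof (cases "n = 0")
    case True
    then have "z ?a = fun_scale (kap n) ?a" using upper_on_unit[OF z n] by simp
    then have "H (z ?a) = fun_scale (kap n) (H ?a)" using coord_linearD(2)[OF H a] by simp
    then show ?thesis using True by (simp add: fun_scale_def)
  next
    case False
    let ?b = "unit_coord (n - 1) :: nat \<Rightarrow> 'f"
    have b: "?b \<in> coord_space d" using n by simp
    have "z ?a = fun_scale (kap n) ?a + fun_scale (u (n - 1)) ?b"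
      using upper_on_unit[OF z n] False by (simp only: if_False)
    then have "H (z ?a) = H (fun_scale (kap n) ?a + fun_scale (u (n - 1)) ?b)" by (rule arg_cong)
    also have "\<dots> = H (fun_scale (kap n) ?a) + H (fun_scale (u (n - 1)) ?b)"
      by (rule coord_linearD(3)[OF H]) (use a b in simp_all)
    also have "\<dots> = fun_scale (kap n) (H ?a) + fun_scale (u (n - 1)) (H ?b)"
      unfolding coord_linearD(2)[OF H a] coord_linearD(2)[OF H b] by (rule refl)
    finally have "H (z ?a) i = (fun_scale (kap n) (H ?a) + fun_scale (u (n - 1)) (H ?b)) i"
      by (rule fun_cong)
    then show ?thesis using False by (simp add: fun_scale_def)
  qed
  have "A (z ?a) i - A' (z ?a) i = kap n * B i"
    using less[of "n - 1"] by (auto simp: expand[OF A] expand[OF A'] B_def algebra_simps)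
  moreover have "z (H ?a) i = kap i * H ?a i + u i * H ?a (Suc i)" if "coord_linear d H" for H
    using z(2) i coord_linearD(1)[OF that a] by (simp add: upper_on_def)
  then have "z (A ?a) i - z (A' ?a) i = kap i * B i + u i * B (Suc i)"
    using A A' by (simp add: B_def algebra_simps)
  moreover have "q * (A (z ?a) i - A' (z ?a) i) = inverse q * (z (A ?a) i - z (A' ?a) i)"
    using rel by (simp add: algebra_simps)
  ultimately have "q * (kap n * B i) = inverse q * (kap i * B i + u i * B (Suc i))" by simp
  then have "q * (q * (kap n * B i)) = q * (inverse q * (kap i * B i + u i * B (Suc i)))" by (rule arg_cong)
  then show ?thesis using q0 by (simp add: kap_Suc power2_eq_square mult.assoc[symmetric])
qed

text \<open>By induction, the image of a unit vector under the difference of two candidates for $x_{01}$ lies in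
  eigenspaces of $x_{12}$ and of $x_{02}$ for the same eigenvalue. But $x_{12} - x_{02}$ annihilates
  only the multiples of the zeroth unit vector, and these belong to a different eigenvalue.\<close>

lemma coord_rep_01_unique:
  assumes Y: "coord_rep q d Y" and T: "coord_rep q d T" and "d \<ge> 1"
    and same: "\<And>a. a \<in> coord_space d \<Longrightarrow> Y 1 2 a = T 1 2 a" "\<And>a. a \<in> coord_space d \<Longrightarrow> Y 0 2 a = T 0 2 a"
    and e: "upper_on (Y 1 2) e" and l: "upper_on (Y 0 2) l" and el: "\<And>i. i < d \<Longrightarrow> e i \<noteq> l i"
    and "a \<in> coord_space d"
  shows "Y 0 1 a = T 0 1 a"
proof -
  interpret Y: coord_rep q d Y by (rule Y)
  interpret T: coord_rep q d T by (rule T)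
  have eq: "Y 0 1 (unit_coord n) = T 0 1 (unit_coord n)" if "n \<le> d" for n
    using that
  proof (induction n rule: less_induct)
    case (less n)
    let ?a = "unit_coord n :: nat \<Rightarrow> 'f"
    let ?B = "\<lambda>i. Y 0 1 ?a i - T 0 1 ?a i"
    have a: "?a \<in> coord_space d" using less.prems by simp
    have IH: "Y 0 1 (unit_coord m) = T 0 1 (unit_coord m)" if "m < n" for m
      using less that by simp
    have E: "kap (Suc n) * ?B i = kap i * ?B i + e i * ?B (Suc i)" if "i \<le> d" for i
    proof (rule intertwining_defect[OF Y.lin T.lin Y.lin e less.prems that IH])
      show "q * Y 0 1 (Y 1 2 ?a) i - inverse q * Y 1 2 (Y 0 1 ?a) i =
          q * T 0 1 (Y 1 2 ?a) i - inverse q * Y 1 2 (T 0 1 ?a) i"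
        using weyl_onD[OF Y.Y_weyls(1) a, of i] weyl_onD[OF T.Y_weyls(1) a, of i] a by (simp add: same)
    qed
    have L: "kap (Suc n) * ?B i = kap i * ?B i + l i * ?B (Suc i)" if "i \<le> d" for i
    proof (rule intertwining_defect[OF Y.lin T.lin Y.lin l less.prems that IH])
      show "q * Y 0 1 (Y 0 2 ?a) i - inverse q * Y 0 2 (Y 0 1 ?a) i =
          q * T 0 1 (Y 0 2 ?a) i - inverse q * Y 0 2 (T 0 1 ?a) i"
        using Y.Y_weyl_02(2)[OF a, of i] T.Y_weyl_02(2)[OF a, of i] a by (simp add: same)
    qed
    have B: "?B (Suc i) = 0" if "i < d" for i
    proof -
      have "(e i - l i) * ?B (Suc i) = 0"
        using E[of i] L[of i] that el[OF that] by (simp add: left_diff_distrib)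
      then show ?thesis using el[OF that] by simp
    qed
    have "(kap (Suc n) - kap 0) * ?B 0 = 0"
      using E[of 0] B[of 0] \<open>d \<ge> 1\<close> by (simp add: left_diff_distrib)
    then have "?B 0 = 0" by (simp add: kap_inj)
    then have "?B i = 0" if "i \<le> d" for i using B[of "i - 1"] that by (cases i) auto
    then show ?case by (intro coord_eqI[of _ d]) (use a in auto)
  qed
  show ?thesis
    by (rule coord_linear_eqI[OF Y.lin T.lin \<open>a \<in> coord_space d\<close> eq])
qed

end

context coord_rep
begin

text \<open>After the superdiagonal of $x_{12}$ has been normalised, the only freedom left is the superdiagonal
  of $x_{02}$. The relation between $x_{12}$ and $x_{20}$ makes the ratios \<open>b\<close> of the two superdiagonals
  satisfy a first order recursion, whose solutions form a one-parameter family: this parameter is \<open>t\<close>.\<close>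

lemma normalized_classification:
  assumes d: "d \<ge> 1" and e: "upper_on (Y 1 2) (\<lambda>i. q ^ d - kap i)"
  shows "\<exists>t. admissible t \<and> (\<forall>i j. j - i = 1 \<or> j - i = 2 \<longrightarrow>
      (\<forall>a\<in>coord_space d. Y i j a = app (gen_op t i j) a))"
proof -
  obtain l where l: "upper_on (Y 0 2) l"
    using weyl_upper_on[OF lin lin diag Y_weyls(7)] by blast
  obtain f where f: "lower_on (Y 3 1) f"
    using weyl_lower_on[OF lin lin diag Y_weyls(5)] by blast
  obtain g where g: "lower_on (Y 3 0) g"
    using weyl_lower_on[OF lin lin diag Y_weyls(3)] by blast
  let ?e = "\<lambda>i. q ^ d - kap i"
  have e_nz: "?e i \<noteq> 0" if "i < d" for i
    using that kap_inj[of d i] by (auto simp: kap_d)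
  have ef: "?e i * f (Suc i) = edge_product i" if "i < d" for i
    by (rule lower_upper_product[OF lin f lin e Y_weyls(9) that])
  have lg: "l i * g (Suc i) = edge_product i" if "i < d" for i
    by (rule lower_upper_product[OF lin g lin l Y_weyls(6) that])
  have l_nz: "l i \<noteq> 0" if "i < d" for i
    using lg[OF that] edge_product_nz[OF that] by auto
  \<comment> \<open>The relation between $x_{12}$ and $x_{20}$ is read off in positions \<open>(i, i + 2)\<close>.\<close>
  define b where "b i = ?e i / l i" for i
  have b_nz: "b i \<noteq> 0" if "i < d" for i using e_nz l_nz that by (simp add: b_def)
  have b_Suc: "q * b (Suc i) - inverse q * b i = q - inverse q" if i: "Suc i < d" for i
  proof -
    let ?a = "unit_coord (Suc (Suc i)) :: nat \<Rightarrow> 'f"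
    have a: "?a \<in> coord_space d" using i by simp
    have up: "y (z ?a) i = u i * w (Suc i)"
      if "upper_on y u" "upper_on z w" "coord_linear d z" for y z u w
    proof -
      have "y (z ?a) i = kap i * z ?a i + u i * z ?a (Suc i)"
        using that i coord_linearD(1)[OF that(3) a] by (simp add: upper_on_def)
      moreover have "z ?a i = 0" "z ?a (Suc i) = w (Suc i)"
        using that(2) a i by (auto simp: upper_on_def unit_coord_apply)
      ultimately show ?thesis by simp
    qed
    have "q * (l i * ?e (Suc i)) - inverse q * (?e i * l (Suc i)) = (q - inverse q) * (l i * l (Suc i))"
      using Y_weyl_02(1)[OF a, of i] by (simp only: up[OF l e lin] up[OF e l lin] up[OF l l lin])
    moreover have "?e i = b i * l i" "?e (Suc i) = b (Suc i) * l (Suc i)"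
      using l_nz i by (simp_all add: b_def)
    ultimately have "(q * b (Suc i) - inverse q * b i) * (l i * l (Suc i)) = (q - inverse q) * (l i * l (Suc i))"
      by (simp add: algebra_simps)
    then show ?thesis using l_nz i by simp
  qed
  \<comment> \<open>Chosen so that \<open>b 0 = 1 - t * inverse q * inverse (kap 0)\<close>.\<close>
  define t where "t = (1 - b 0) * q * kap 0"
  have b: "b i = 1 - t * inverse q * inverse (kap i)" if "i < d" for i
    using that
  proof (induction i)
    case 0
    then show ?case using q0 by (simp add: t_def field_simps)
  next
    case (Suc i)
    have "q * (q * b (Suc i) - inverse q * b i) = q * (q - inverse q)"
      using b_Suc[OF Suc.prems] by simp
    then have "q\<^sup>2 * b (Suc i) = q\<^sup>2 - 1 + b i"
      using q0 by (simp add: algebra_simps power2_eq_square)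
    then have "q\<^sup>2 * b (Suc i) = q\<^sup>2 * (1 - t * inverse q * inverse (kap (Suc i)))"
      using Suc q0 by (simp add: kap_Suc right_diff_distrib)
    then show ?case using q0 by simp
  qed
  have l_eq: "l i = ?e i * inverse (1 - t * inverse q * inverse (kap i))" if "i < d" for i
  proof -
    have "l i = ?e i * inverse (b i)" using l_nz[OF that] e_nz[OF that] by (simp add: b_def)
    then show ?thesis by (simp add: b[OF that])
  qed
  have f_eq: "f (Suc i) = inverse (q ^ d) - kap (Suc i)" if "i < d" for i
    using ef[OF that] e_nz[OF that] by (simp add: edge_product_def kap_Suc)
  have g_eq: "g (Suc i) = (inverse (q ^ d) - kap (Suc i)) * (1 - t * q * inverse (kap (Suc i)))"
    if "i < d" for i
  proof -
    have "l i * g (Suc i) = ?e i * f (Suc i)" using lg ef that by simp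
    also have "?e i = b i * l i" using l_nz[OF that] by (simp add: b_def)
    finally have "g (Suc i) = b i * f (Suc i)" using l_nz[OF that] by simp
    moreover have "t * q * inverse (kap (Suc i)) = t * inverse q * inverse (kap i)"
      using q0 by (simp add: kap_Suc field_simps power2_eq_square)
    ultimately show ?thesis by (simp only: b[OF that] f_eq[OF that] mult.commute)
  qed
  \<comment> \<open>For \<open>t = 0\<close> the operators of $x_{02}$ and $x_{12}$ coincide; comparing their relations with $x_{01}$ shows that the square of this operator is the identity, but \<open>kap 0\<close> is not a square root of 1.\<close>
  have t_nz: "t \<noteq> 0"
  proof
    assume "t = 0"
    then have le: "l i = ?e i" if "i < d" for i using l_eq that by simp
    have same: "Y 0 2 a = Y 1 2 a" if a: "a \<in> coord_space d" for a
    proof (rule coord_eqI[of _ d])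
      show "Y 0 2 a i = Y 1 2 a i" if "i \<le> d" for i
        using e l a le that by (cases "i = d") (auto simp: upper_on_def coord_space_beyond)
    qed (use a in auto)
    let ?a = "unit_coord 0 :: nat \<Rightarrow> 'f"
    have a: "?a \<in> coord_space d" by simp
    have "(q - inverse q) * Y 0 2 (Y 0 2 ?a) 0 = (q - inverse q) * ?a 0"
      using Y_weyl_02(2)[OF a, of 0] weyl_onD[OF Y_weyls(1) a, of 0] by (auto simp: same a)
    then have "Y 0 2 (Y 0 2 ?a) 0 = 1" using q_diff by (simp add: unit_coord_apply)
    moreover have "Y 0 2 ?a = fun_scale (kap 0) ?a" using upper_on_unit[OF lin l, of 0] by simp
    moreover have "Y 0 2 (fun_scale (kap 0) ?a) = fun_scale (kap 0) (Y 0 2 ?a)"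
      by (rule coord_linearD(2)[OF lin a])
    ultimately have "kap 0 * kap 0 = 1" by (simp add: fun_scale_def unit_coord_apply)
    then have "q ^ d * q ^ d = 1" using q0 by (simp add: kap_0 field_simps)
    then have "q ^ (d + d) = 1" by (simp add: power_add)
    then show False using nonroot[of "d + d"] d by simp
  qed
  have adm: "admissible t"
    unfolding admissible_def using t_nz b b_nz by fastforce
  interpret T: coord_rep q d "\<lambda>i j. app (gen_op t i j)" by (rule coord_rep_gen_op[OF adm])
  have Y23: "Y 2 3 a = app (gen_op t 2 3) a" if a: "a \<in> coord_space d" for a
    by (rule coord_eqI[of _ d]) (use a diag T.diag T.Y_closed[OF a] in \<open>auto simp: diag_on_def\<close>)
  have Y12: "Y 1 2 a = app (gen_op t 1 2) a" if a: "a \<in> coord_space d" for a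
    by (rule upper_on_eqI[OF lin e gen_op_12 _ a]) simp
  have Y02: "Y 0 2 a = app (gen_op t 0 2) a" if a: "a \<in> coord_space d" for a
    by (rule upper_on_eqI[OF lin l gen_op_02 _ a]) (rule l_eq)
  have Y31: "Y 3 1 a = app (gen_op t 3 1) a" if a: "a \<in> coord_space d" for a
    by (rule lower_on_eqI[OF lin f gen_op_31 _ a]) (rule f_eq)
  have Y30: "Y 3 0 a = app (gen_op t 3 0) a" if a: "a \<in> coord_space d" for a
    by (rule lower_on_eqI[OF lin g gen_op_30 _ a]) (rule g_eq)
  have Y20: "Y 2 0 a = app (gen_op t 2 0) a" if a: "a \<in> coord_space d" for a
    using T.Y_inverse(2)[of "Y 2 0 a"] Y02[of "Y 2 0 a"] Y_inverse(1)[OF a] a by simp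
  have Y13: "Y 1 3 a = app (gen_op t 1 3) a" if a: "a \<in> coord_space d" for a
    using T.Y_inverse(4)[of "Y 1 3 a"] Y31[of "Y 1 3 a"] Y_inverse(3)[OF a] a by simp
  have el: "?e i \<noteq> l i" if "i < d" for i
  proof
    assume "?e i = l i"
    then have "b i = 1" using l_nz[OF that] by (simp add: b_def)
    then show False using b[OF that] t_nz q0 by simp
  qed
  have Y01: "Y 0 1 a = app (gen_op t 0 1) a" if a: "a \<in> coord_space d" for a
    by (rule coord_rep_01_unique[OF coord_rep_axioms T.coord_rep_axioms d Y12 Y02 e l el a])
  have "Y i j a = app (gen_op t i j) a" if "j - i = 1 \<or> j - i = 2" "a \<in> coord_space d" for i j a
    using that(1) Y23[OF that(2)] Y12[OF that(2)] Y02[OF that(2)] Y31[OF that(2)] Y30[OF that(2)]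
      Y20[OF that(2)] Y13[OF that(2)] Y01[OF that(2)]
    unfolding index_diff by (elim disjE conjE; simp only:)
  with adm show ?thesis by blast
qed

definition rescale :: "(nat \<Rightarrow> 'f) \<Rightarrow> (nat \<Rightarrow> 'f) \<Rightarrow> nat \<Rightarrow> 'f" where
  "rescale c a = (\<lambda>n. c n * a n)"

lemma rescale_simps [simp]:
  "a \<in> coord_space d \<Longrightarrow> rescale c a \<in> coord_space d"
  "rescale c (fun_scale s a) = fun_scale s (rescale c a)"
  "rescale c (a + b) = rescale c a + rescale c b"
  by (auto simp: rescale_def coord_space_def fun_scale_def fun_eq_iff algebra_simps)

lemma rescale_inverse:
  assumes "\<And>n. c n \<noteq> 0"
  shows "rescale c (rescale (\<lambda>n. inverse (c n)) a) = a" "rescale (\<lambda>n. inverse (c n)) (rescale c a) = a"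
  using assms by (auto simp: rescale_def)

lemma coord_rep_rescale:
  assumes c: "\<And>n. c n \<noteq> 0"
  shows "coord_rep q d (\<lambda>i j a. rescale (\<lambda>n. inverse (c n)) (Y i j (rescale c a)))"
proof
  show "coord_linear d (\<lambda>a. rescale (\<lambda>n. inverse (c n)) (Y i j (rescale c a)))" for i j
    using coord_linearD[OF lin[of i j]] unfolding coord_linear_def by simp
  show "rescale (\<lambda>n. inverse (c n)) (Y i j (rescale c (rescale (\<lambda>n. inverse (c n)) (Y j i (rescale c a))))) = a"
    if "j - i = 2" "a \<in> coord_space d" for i j :: 4 and a
    using that by (simp add: rescale_inverse[OF c] inv)
  show "weyl_on (\<lambda>a. rescale (\<lambda>n. inverse (c n)) (Y i j (rescale c a)))
      (\<lambda>a. rescale (\<lambda>n. inverse (c n)) (Y j k (rescale c a)))"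
    if ijk: "(j - i, k - j) \<in> {(1, 1), (1, 2), (2, 1)}" for i j k
    unfolding weyl_on_def
  proof (intro ballI allI)
    fix a :: "nat \<Rightarrow> 'f" and n assume a: "a \<in> coord_space d"
    have "q * Y i j (Y j k (rescale c a)) n - inverse q * Y j k (Y i j (rescale c a)) n
        = (q - inverse q) * rescale c a n"
      by (rule weyl_onD[OF weyl_Y[OF ijk]]) (use a in simp)
    then have "inverse (c n) * (q * Y i j (Y j k (rescale c a)) n - inverse q * Y j k (Y i j (rescale c a)) n)
        = inverse (c n) * ((q - inverse q) * rescale c a n)"
      by simp
    then show "q * rescale (\<lambda>n. inverse (c n)) (Y i j (rescale c (rescale (\<lambda>n. inverse (c n)) (Y j k (rescale c a))))) n
        - inverse q * rescale (\<lambda>n. inverse (c n)) (Y j k (rescale c (rescale (\<lambda>n. inverse (c n)) (Y i j (rescale c a))))) n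
        = (q - inverse q) * a n"
      unfolding rescale_inverse[OF c] using c[of n]
      by (simp add: rescale_def algebra_simps)
  qed
  show "diag_on (\<lambda>a. rescale (\<lambda>n. inverse (c n)) (Y 2 3 (rescale c a)))"
    using diag c unfolding diag_on_def by (auto simp: rescale_def[of "\<lambda>n. inverse (c n)"]) (simp add: rescale_def)
qed

text \<open>Rescaling the basis vectors brings the superdiagonal of $x_{12}$ into the prescribed form; it has no
  zero, since its products with the subdiagonal of $x_{31}$ are known and nonzero.\<close>

theorem classification:
  assumes d: "d \<ge> 1"
  shows "\<exists>t c. admissible t \<and> (\<forall>n. c n \<noteq> 0) \<and> (\<forall>i j. j - i = 1 \<or> j - i = 2 \<longrightarrow>
      (\<forall>a\<in>coord_space d. Y i j (rescale c a) = rescale c (app (gen_op t i j) a)))"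
proof -
  obtain e where e: "upper_on (Y 1 2) e"
    using weyl_upper_on[OF lin lin diag Y_weyls(2)] by blast
  obtain f where f: "lower_on (Y 3 1) f"
    using weyl_lower_on[OF lin lin diag Y_weyls(5)] by blast
  have e_nz: "e i \<noteq> 0" if "i < d" for i
    using lower_upper_product[OF lin f lin e Y_weyls(9) that] edge_product_nz[OF that] by auto
  \<comment> \<open>The solution of \<open>e i * c (Suc i) = (q ^ d - kap i) * c i\<close> with \<open>c 0 = 1\<close>, continued by a constant beyond \<open>d\<close>.\<close>
  define c where "c n = (\<Prod>i<n. if i < d then (q ^ d - kap i) / e i else 1)" for n
  have "q ^ d - kap i \<noteq> 0" if "i < d" for i
    using that kap_inj[of d i] by (auto simp: kap_d)
  then have c: "c n \<noteq> 0" for n using e_nz by (auto simp: c_def)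
  interpret Z: coord_rep q d "\<lambda>i j a. rescale (\<lambda>n. inverse (c n)) (Y i j (rescale c a))"
    by (rule coord_rep_rescale[OF c])
  have "upper_on (\<lambda>a. rescale (\<lambda>n. inverse (c n)) (Y 1 2 (rescale c a))) (\<lambda>i. q ^ d - kap i)"
    unfolding upper_on_def
  proof (intro ballI allI impI)
    fix a :: "nat \<Rightarrow> 'f" and i assume a: "a \<in> coord_space d" and i: "i \<le> d"
    have "rescale (\<lambda>n. inverse (c n)) (Y 1 2 (rescale c a)) i
        = inverse (c i) * (kap i * (c i * a i) + e i * (c (Suc i) * a (Suc i)))"
      using e[unfolded upper_on_def, rule_format, OF rescale_simps(1)[OF a] i, of c]
      by (simp add: rescale_def)
    also have "\<dots> = kap i * a i + (q ^ d - kap i) * a (Suc i)"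
    proof (cases "i < d")
      case True
      then have "e i * c (Suc i) = (q ^ d - kap i) * c i" using e_nz by (simp add: c_def)
      then have "e i * (c (Suc i) * a (Suc i)) = (q ^ d - kap i) * c i * a (Suc i)"
        by (simp flip: mult.assoc)
      then show ?thesis using c[of i] by (simp add: distrib_left field_simps)
    next
      case False
      then show ?thesis using i a c[of i] by (simp add: coord_space_beyond)
    qed
    finally show "rescale (\<lambda>n. inverse (c n)) (Y 1 2 (rescale c a)) i
        = kap i * a i + (q ^ d - kap i) * a (Suc i)" .
  qed
  from Z.normalized_classification[OF d this] obtain t where t: "admissible t" and
    eq: "\<And>i j a. j - i = 1 \<or> j - i = 2 \<Longrightarrow> a \<in> coord_space d \<Longrightarrow>
      rescale (\<lambda>n. inverse (c n)) (Y i j (rescale c a)) = app (gen_op t i j) a"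
    by blast
  have "Y i j (rescale c a) = rescale c (app (gen_op t i j) a)"
    if "j - i = 1 \<or> j - i = 2" "a \<in> coord_space d" for i j a
    using arg_cong[OF eq[OF that], of "rescale c"] by (simp only: rescale_inverse(1)[OF c])
  with t c show ?thesis by blast
qed

end

section \<open>Eigenbases and isomorphisms\<close>

lemma fa_const_central: "fa_const c * p = p * fa_const c"
proof (induction p rule: free_alg_induct_single)
  case (single w b)
  show ?case by (simp add: fa_const_def mult_single mult.commute)
qed (simp add: algebra_simps)

locale box_module =
  fixes q :: "'f::field" and V :: "('f, 'v::ab_group_add) qmod"
  assumes module: "boxtimes_module q V"
begin

abbreviation act :: "'f free_alg \<Rightarrow> 'v \<Rightarrow> 'v" where
  "act p v \<equiv> mod_act V (box_proj q p) v"

sublocale vector_space "mod_scale V"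
  using module by (simp add: boxtimes_module_def)

lemma subspace_mod_space: "subspace (mod_space V)"
  using module by (simp add: boxtimes_module_def)

lemmas mod_space_closed = subspace_0[OF subspace_mod_space] subspace_add[OF subspace_mod_space]
  subspace_scale[OF subspace_mod_space] subspace_diff[OF subspace_mod_space]

lemma act_closed: "v \<in> mod_space V \<Longrightarrow> act p v \<in> mod_space V"
  using module box_proj_simps(1)[of q p] by (simp add: boxtimes_module_def)

lemma act_add_vec: "v \<in> mod_space V \<Longrightarrow> w \<in> mod_space V \<Longrightarrow> act p (v + w) = act p v + act p w"
  using module box_proj_simps(1)[of q p] by (simp add: boxtimes_module_def)

lemma act_add: "v \<in> mod_space V \<Longrightarrow> act (p + r) v = act p v + act r v"
  unfolding box_proj_simps
  using module box_proj_simps(1)[of q] by (simp add: boxtimes_module_def)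

lemma act_mult: "v \<in> mod_space V \<Longrightarrow> act (p * r) v = act p (act r v)"
  unfolding box_proj_simps
  using module box_proj_simps(1)[of q] by (simp add: boxtimes_module_def)

lemma act_one: "v \<in> mod_space V \<Longrightarrow> act 1 v = v"
  unfolding box_proj_simps using module by (simp add: boxtimes_module_def)

lemma act_const: "v \<in> mod_space V \<Longrightarrow> act (fa_const c) v = mod_scale V c v"
  using module by (simp add: boxtimes_module_def)

lemma act_scale: "v \<in> mod_space V \<Longrightarrow> act p (mod_scale V c v) = mod_scale V c (act p v)"
  by (metis act_mult act_const act_closed fa_const_central)

lemma act_diff: "v \<in> mod_space V \<Longrightarrow> act (p - r) v = act p v - act r v"
  using act_add[of v "p - r" r] by simp

lemma act_zero_vec: "act p 0 = 0"
  using act_add_vec[of 0 0 p] mod_space_closed(1) by simp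

lemma act_relator:
  assumes "r \<in> relators q" "v \<in> mod_space V"
  shows "act r v = 0"
  using act_const[OF assms(2), of 0] by (simp add: box_proj_relator[OF assms(1)] fa_const_def)

lemma act_inv:
  assumes "j - i = 2" "v \<in> mod_space V"
  shows "act (fa_var i j) (act (fa_var j i) v) = v"
  using act_relator[OF relators.inv[OF assms(1)] assms(2)] assms(2)
  by (simp add: act_diff act_mult act_one)

lemma act_weyl:
  assumes "q - inverse q \<noteq> 0" "(j - i, k - j) \<in> {(1, 1), (1, 2), (2, 1)}" "v \<in> mod_space V"
  shows "mod_scale V q (act (fa_var i j) (act (fa_var j k) v))
    - mod_scale V (inverse q) (act (fa_var j k) (act (fa_var i j) v)) = mod_scale V (q - inverse q) v"
proof -
  let ?w = "mod_scale V q (act (fa_var i j) (act (fa_var j k) v))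
    - mod_scale V (inverse q) (act (fa_var j k) (act (fa_var i j) v))"
  have "mod_scale V (1 / (q - inverse q)) ?w - v = 0"
    using act_relator[OF relators.weyl[OF assms(2)] assms(3)] assms(3)
    by (simp add: act_diff act_mult act_one act_const act_closed mod_space_closed)
  then have "mod_scale V (q - inverse q) (mod_scale V (1 / (q - inverse q)) ?w) = mod_scale V (q - inverse q) v"
    by simp
  then show ?thesis using assms(1) by simp
qed

lemma act_sum:
  assumes "\<And>n. n \<in> A \<Longrightarrow> f n \<in> mod_space V"
  shows "act p (\<Sum>n\<in>A. f n) = (\<Sum>n\<in>A. act p (f n))"
  using assms
proof (induction A rule: infinite_finite_induct)
  case (insert n A)
  have "(\<Sum>n\<in>A. f n) \<in> mod_space V"
    by (rule subspace_sum[OF subspace_mod_space]) (use insert in auto)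
  then show ?case using insert by (simp add: act_add_vec)
qed (simp_all add: act_zero_vec)

lemma subspace_eigenspace: "subspace (eigenspace V (box_proj q p) c)"
  by (auto simp: subspace_def eigenspace_def mod_space_closed act_zero_vec act_add_vec act_scale
      scale_right_distrib mult.commute)

text \<open>Applying the operator and subtracting a multiple of the given relation removes one of the terms.\<close>

lemma eigenvectors_independent:
  assumes "finite A" "inj_on k A"
    and "\<And>n. n \<in> A \<Longrightarrow> v n \<in> eigenspace V (box_proj q p) (k n) - {0}"
    and "(\<Sum>n\<in>A. mod_scale V (a n) (v n)) = 0" and "n \<in> A"
  shows "a n = 0"
  using assms
proof (induction A arbitrary: a n)
  case (insert m A)
  have S: "v n \<in> mod_space V" "act p (v n) = mod_scale V (k n) (v n)" "v n \<noteq> 0" if "n \<in> insert m A" for n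
    using insert.prems(2)[OF that] by (auto simp: eigenspace_def)
  let ?s = "\<Sum>n\<in>insert m A. mod_scale V (a n) (v n)"
  have "act p ?s = (\<Sum>n\<in>insert m A. act p (mod_scale V (a n) (v n)))"
    by (rule act_sum) (use S in \<open>auto simp: mod_space_closed\<close>)
  also have "\<dots> = (\<Sum>n\<in>insert m A. mod_scale V (a n * k n) (v n))"
    by (rule sum.cong) (simp_all add: act_scale S)
  finally have "(\<Sum>n\<in>insert m A. mod_scale V (a n * k n) (v n)) - mod_scale V (k m) ?s = 0"
    using insert.prems(3) by (simp add: act_zero_vec)
  moreover have "mod_scale V (a n * k n) (v n) - mod_scale V (k m) (mod_scale V (a n) (v n))
      = mod_scale V (a n * (k n - k m)) (v n)" for n
    by (simp add: right_diff_distrib scale_left_diff_distrib mult.commute)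
  ultimately have "(\<Sum>n\<in>insert m A. mod_scale V (a n * (k n - k m)) (v n)) = 0"
    unfolding scale_sum_right sum_subtractf[symmetric] by simp
  then have 0: "(\<Sum>n\<in>A. mod_scale V (a n * (k n - k m)) (v n)) = 0"
    using insert.hyps by simp
  have A: "a n = 0" if "n \<in> A" for n
  proof -
    have "a n * (k n - k m) = 0"
      by (rule insert.IH[OF _ _ 0 that]) (use insert.prems(1,2) in \<open>auto simp: inj_on_def\<close>)
    moreover have "k n \<noteq> k m" using insert.prems(1) insert.hyps that by (auto simp: inj_on_def)
    ultimately show ?thesis by simp
  qed
  then have "mod_scale V (a m) (v m) = 0" using insert.prems(3) insert.hyps by simp
  then have "a m = 0" using S[of m] by simp
  then show ?case using A insert.prems(4) by auto
qed simp

end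

context nonroot
begin

text \<open>The number of eigenvalues recovers the diameter, so the diameter in the definition of the shape
  agrees with the given one.\<close>

lemma card_eigenvalue_set:
  assumes "\<epsilon> \<noteq> 0"
  shows "card {\<epsilon> * q powi (int m - 2 * int n) |n. n \<le> m} = m + 1"
proof -
  have "{\<epsilon> * q powi (int m - 2 * int n) |n. n \<le> m} = (\<lambda>n. \<epsilon> * q powi (int m - 2 * int n)) ` {..m}"
    by auto
  moreover have "inj_on (\<lambda>n. \<epsilon> * q powi (int m - 2 * int n)) {..m}"
    using assms by (auto simp: inj_on_def powi_inj)
  ultimately show ?thesis by (simp add: card_image)
qed

text \<open>Only the generators have to be compared: both sides act through the free algebra.\<close>

lemma isomorphic_VdI:
  assumes V: "boxtimes_module q V" and t: "admissible t"
    and bij: "bij_betw \<psi> (coord_space d) (mod_space V)"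
    and add: "\<And>a b. a \<in> coord_space d \<Longrightarrow> b \<in> coord_space d \<Longrightarrow> \<psi> (a + b) = \<psi> a + \<psi> b"
    and scale: "\<And>c a. a \<in> coord_space d \<Longrightarrow> \<psi> (fun_scale c a) = mod_scale V c (\<psi> a)"
    and gen: "\<And>i j a. j - i = 1 \<or> j - i = 2 \<Longrightarrow> a \<in> coord_space d \<Longrightarrow>
      mod_act V (xgen q i j) (\<psi> a) = \<psi> (app (gen_op t i j) a)"
  shows "isomorphic_modules q V (Vd q d t)"
proof -
  interpret box_module q V by unfold_locales (rule V)
  have S: "mod_space (Vd q d t) = coord_space d" by (simp add: Vd_def coord_space_def)
  have closed: "app (free_eval (gen_op t) p) a \<in> coord_space d" if "a \<in> coord_space d" for p a
    using free_eval_gen_op_closed[of a t p] that by (simp add: coord_space_def)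
  have \<psi>: "\<psi> a \<in> mod_space V" if "a \<in> coord_space d" for a
    using bij that by (auto simp: bij_betw_def)
  have act: "act p (\<psi> a) = \<psi> (app (free_eval (gen_op t) p) a)" if "a \<in> coord_space d" for p a
    using that
  proof (induction p arbitrary: a rule: free_alg_induct)
    case (const c)
    then show ?case by (simp add: act_const \<psi> free_eval_simps app_scalar scale)
  next
    case (var i j p)
    then show ?case
      using gen[OF var(1) closed[OF var(3)], of p] closed
      by (simp add: act_mult \<psi> free_eval_simps free_eval_var app_simps xgen_def)
  next
    case (add p r)
    have "act (p + r) (\<psi> a) = act p (\<psi> a) + act r (\<psi> a)"
      by (rule act_add[OF \<psi>[OF add(3)]])
    also have "\<dots> = \<psi> (app (free_eval (gen_op t) p) a + app (free_eval (gen_op t) r) a)"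
      unfolding add(1)[OF add(3)] add(2)[OF add(3)]
      by (rule assms(4)[symmetric]) (rule closed[OF add(3)])+
    finally show ?case by (simp only: free_eval_simps app_simps)
  qed
  define \<phi> where "\<phi> = the_inv_into (coord_space d) \<psi>"
  have \<phi>_\<psi>: "\<phi> (\<psi> a) = a" if "a \<in> coord_space d" for a
    unfolding \<phi>_def using bij that by (auto simp: bij_betw_def the_inv_into_f_f)
  have \<psi>_ex: "\<exists>a\<in>coord_space d. v = \<psi> a" if "v \<in> mod_space V" for v
    using bij that by (auto simp: bij_betw_def)
  show ?thesis
    unfolding isomorphic_modules_def
  proof (intro conjI exI[of _ \<phi>] ballI)
    show "boxtimes_module q V" by (rule V)
    show "boxtimes_module q (Vd q d t)" by (rule Vd_module[OF t])
    show "bij_betw \<phi> (mod_space V) (mod_space (Vd q d t))"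
      unfolding \<phi>_def S by (rule bij_betw_the_inv_into[OF bij])
    fix v assume "v \<in> mod_space V"
    then obtain a where a: "a \<in> coord_space d" "v = \<psi> a" using \<psi>_ex by blast
    show "\<phi> (v + w) = \<phi> v + \<phi> w" if w: "w \<in> mod_space V" for w
    proof -
      obtain b where b: "b \<in> coord_space d" "w = \<psi> b" using w \<psi>_ex by blast
      have "\<phi> (\<psi> (a + b)) = a + b" by (rule \<phi>_\<psi>) (rule coord_space_closed(2)[OF a(1) b(1)])
      then show ?thesis using \<phi>_\<psi> a b by (simp only: add)
    qed
    fix x assume "x \<in> carrier (boxtimes q)"
    then obtain p where p: "x = box_proj q p" by (rule boxtimes_carrierE)
    show "\<phi> (mod_act V x v) = mod_act (Vd q d t) x (\<phi> v)"
      using a closed[OF a(1), of p] by (simp add: p act \<phi>_\<psi> Vd_act[OF t] S)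
  qed
qed

lemma isomorphic_Vd_Vd:
  assumes "isomorphic_modules q V (Vd q d t)" "isomorphic_modules q V (Vd q d t')"
  shows "isomorphic_modules q (Vd q d t) (Vd q d t')"
proof -
  obtain f g where f: "bij_betw f (mod_space V) (mod_space (Vd q d t))"
      "\<And>v w. v \<in> mod_space V \<Longrightarrow> w \<in> mod_space V \<Longrightarrow> f (v + w) = f v + f w"
      "\<And>a v. a \<in> carrier (boxtimes q) \<Longrightarrow> v \<in> mod_space V \<Longrightarrow> f (mod_act V a v) = mod_act (Vd q d t) a (f v)"
    and g: "bij_betw g (mod_space V) (mod_space (Vd q d t'))"
      "\<And>v w. v \<in> mod_space V \<Longrightarrow> w \<in> mod_space V \<Longrightarrow> g (v + w) = g v + g w"
      "\<And>a v. a \<in> carrier (boxtimes q) \<Longrightarrow> v \<in> mod_space V \<Longrightarrow> g (mod_act V a v) = mod_act (Vd q d t') a (g v)"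
    and m: "boxtimes_module q V" "boxtimes_module q (Vd q d t)" "boxtimes_module q (Vd q d t')"
    using assms unfolding isomorphic_modules_def by blast
  interpret box_module q V by unfold_locales (rule m)
  let ?h = "the_inv_into (mod_space V) f"
  have h: "bij_betw ?h (mod_space (Vd q d t)) (mod_space V)" by (rule bij_betw_the_inv_into[OF f(1)])
  have inj: "inj_on f (mod_space V)" using f(1) by (simp add: bij_betw_def)
  have hf: "?h (f v) = v" if "v \<in> mod_space V" for v using the_inv_into_f_f[OF inj that] .
  have ex: "\<exists>v\<in>mod_space V. a = f v" if "a \<in> mod_space (Vd q d t)" for a
    using f(1) that by (auto simp: bij_betw_def)
  show ?thesis
    unfolding isomorphic_modules_def
  proof (intro conjI exI[of _ "g \<circ> ?h"] ballI)
    show "boxtimes_module q (Vd q d t)" "boxtimes_module q (Vd q d t')" using m by auto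
    show "bij_betw (g \<circ> ?h) (mod_space (Vd q d t)) (mod_space (Vd q d t'))"
      by (rule bij_betw_trans[OF h g(1)])
    fix a assume "a \<in> mod_space (Vd q d t)"
    then obtain v where v: "v \<in> mod_space V" "a = f v" using ex by blast
    show "(g \<circ> ?h) (a + b) = (g \<circ> ?h) a + (g \<circ> ?h) b" if b: "b \<in> mod_space (Vd q d t)" for b
    proof -
      obtain w where w: "w \<in> mod_space V" "b = f w" using ex b by blast
      have "?h (a + b) = v + w"
        unfolding v(2) w(2) f(2)[OF v(1) w(1), symmetric]
        by (rule hf) (rule mod_space_closed(2)[OF v(1) w(1)])
      then show ?thesis using v w g(2) by (simp add: hf)
    qed
    fix x assume x: "x \<in> carrier (boxtimes q)"
    obtain p where p: "x = box_proj q p" using x by (rule boxtimes_carrierE)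
    have "?h (mod_act (Vd q d t) x a) = mod_act V x v"
      unfolding v(2) f(3)[OF x v(1), symmetric] by (rule hf) (use act_closed[OF v(1)] p in simp)
    then show "(g \<circ> ?h) (mod_act (Vd q d t) x a) = mod_act (Vd q d t') x ((g \<circ> ?h) a)"
      using v g(3)[OF x v(1)] by (simp add: hf)
  qed
qed

lemma admissible_iff:
  "admissible t \<longleftrightarrow> t \<noteq> 0 \<and> t \<notin> {q powi (int d - 2 * int n + 1) |n. n \<in> {1..d}}"
proof -
  have "t * inverse q * inverse (kap i) = 1 \<longleftrightarrow> t = q powi (int d - 2 * int (d - i) + 1)" if "i < d" for i
  proof -
    have "q powi (int d - 2 * int (d - i) + 1) = q * kap i"
      using that by (intro powi_eqs) (simp add: of_nat_diff)
    then show ?thesis using q0 by (auto simp: field_simps)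
  qed
  then have *: "(\<forall>i<d. t * inverse q * inverse (kap i) \<noteq> 1) \<longleftrightarrow>
      (\<forall>i<d. t \<noteq> q powi (int d - 2 * int (d - i) + 1))"
    by blast
  have reflect: "(\<forall>i<d. P (d - i)) \<longleftrightarrow> (\<forall>n\<in>{1..d}. P n)" for P
  proof
    assume P: "\<forall>i<d. P (d - i)"
    show "\<forall>n\<in>{1..d}. P n"
    proof
      fix n assume "n \<in> {1..d}"
      then have "d - n < d" "d - (d - n) = n" by auto
      with P show "P n" by metis
    qed
  qed auto
  show ?thesis
    unfolding admissible_def * reflect[of "\<lambda>n. t \<noteq> q powi (int d - 2 * int n + 1)"] by blast
qed

text \<open>An isomorphism commutes with $x_{23}$, so it multiplies the unit vectors by scalars. Because it
  commutes with $x_{12}$, which has the same nonzero entry in position \<open>(0, 1)\<close> for both parameters,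
  the scalars on the unit vectors 0 and 1 agree. Then the entries of $x_{02}$ in position \<open>(0, 1)\<close>
  agree, and they determine the parameter.\<close>

lemma isomorphic_Vd_parameter:
  assumes d: "d \<ge> 1" and t: "admissible t" and t': "admissible t'"
    and iso: "isomorphic_modules q (Vd q d t) (Vd q d t')"
  shows "t = t'"
proof -
  obtain h where h: "bij_betw h (mod_space (Vd q d t)) (mod_space (Vd q d t'))"
      "\<And>v w. v \<in> mod_space (Vd q d t) \<Longrightarrow> w \<in> mod_space (Vd q d t) \<Longrightarrow> h (v + w) = h v + h w"
      "\<And>a v. a \<in> carrier (boxtimes q) \<Longrightarrow> v \<in> mod_space (Vd q d t) \<Longrightarrow>
        h (mod_act (Vd q d t) a v) = mod_act (Vd q d t') a (h v)"
    using iso unfolding isomorphic_modules_def by blast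
  have S: "mod_space (Vd q d s) = coord_space d" for s by (simp add: Vd_def coord_space_def)
  have closed: "h a \<in> coord_space d" if "a \<in> coord_space d" for a
    using h(1) that unfolding S by (auto simp: bij_betw_def)
  have eval: "h (app (free_eval (gen_op t) p) a) = app (free_eval (gen_op t') p) (h a)"
    if "a \<in> coord_space d" for p a
    using h(3)[OF box_proj_simps(1), of a p] that closed[OF that] by (simp add: S Vd_act t t')
  have gen: "h (app (gen_op t i j) a) = app (gen_op t' i j) (h a)"
    if "j - i = 1 \<or> j - i = 2" "a \<in> coord_space d" for i j a
    using eval[OF that(2), of "fa_var i j"] by (simp add: free_eval_var[OF that(1)])
  have scale: "h (fun_scale c a) = fun_scale c (h a)" if "a \<in> coord_space d" for c a
    using eval[OF that, of "fa_const c"] by (simp add: free_eval_simps app_scalar)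
  interpret T: coord_rep q d "\<lambda>i j. app (gen_op t i j)" by (rule coord_rep_gen_op[OF t])
  let ?b = "unit_coord 0 :: nat \<Rightarrow> 'f" and ?a = "unit_coord 1 :: nat \<Rightarrow> 'f"
  have a: "?a \<in> coord_space d" and b: "?b \<in> coord_space d" using d by auto
  have h_a: "h ?a i = 0" if "i \<noteq> 1" for i
  proof (cases "i \<le> d")
    case True
    have "app (gen_op t 2 3) ?a = fun_scale (inverse (kap 1)) ?a"
      by (rule diag_on_unit[OF T.lin T.diag d])
    then have "fun_scale (inverse (kap 1)) (h ?a) = app (gen_op t' 2 3) (h ?a)"
      using gen[of 3 2 ?a] a by (simp add: scale)
    from fun_cong[OF this, of i] have "inverse (kap 1) * h ?a i = inverse (kap i) * h ?a i"
      using True by (simp add: fun_scale_def gen_op_23)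
    then show ?thesis using that by (auto simp: kap_inj)
  qed (use closed[OF a] in \<open>simp add: coord_space_beyond\<close>)
  have nz: "h ?a 1 \<noteq> 0"
  proof
    assume "h ?a 1 = 0"
    then have "h ?a i = 0" for i using h_a[of i] by (cases "i = 1") simp_all
    then have "h ?a = 0" by (simp add: fun_eq_iff)
    moreover have "h (fun_scale 0 ?a) = fun_scale 0 (h ?a)" by (rule scale[OF a])
    then have "h (fun_scale 0 ?a) = 0" by (simp add: fun_scale_def fun_eq_iff)
    moreover have "inj_on h (coord_space d)" using h(1) by (simp add: bij_betw_def S)
    ultimately have "?a = fun_scale 0 ?a"
      using a coord_space_closed(3)[OF a] by (metis inj_onD)
    from fun_cong[OF this, of 1] show False by (simp add: fun_scale_def unit_coord_apply)
  qed
  have row: "u 0 * h ?b 0 = u' 0 * h ?a 1"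
    if ij: "j - i = 1 \<or> j - i = 2" and up: "upper (gen_op t i j) u" and up': "upper (gen_op t' i j) u'"
    for i j u u'
  proof -
    have on: "upper_on (app (gen_op t i j)) u" using up by (simp add: upper_def upper_on_def)
    have "app (gen_op t i j) ?a = fun_scale (kap 1) ?a + fun_scale (u 0) ?b"
      using upper_on_unit[OF T.lin on d] by (simp only: if_False) simp
    then have "h (app (gen_op t i j) ?a) = h (fun_scale (kap 1) ?a + fun_scale (u 0) ?b)" by (rule arg_cong)
    also have "\<dots> = fun_scale (kap 1) (h ?a) + fun_scale (u 0) (h ?b)"
      using h(2)[unfolded S, OF coord_space_closed(3)[OF a] coord_space_closed(3)[OF b]]
      by (simp only: scale a b)
    finally have "app (gen_op t' i j) (h ?a) = fun_scale (kap 1) (h ?a) + fun_scale (u 0) (h ?b)"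
      by (simp only: gen[OF ij a])
    from fun_cong[OF this, of 0] show ?thesis
      using up' d h_a[of 0] by (simp add: upper_def fun_scale_def)
  qed
  have e_nz: "q ^ d - kap 0 \<noteq> 0" using kap_inj[of d 0] d by (simp add: kap_d)
  have "(q ^ d - kap 0) * h ?b 0 = (q ^ d - kap 0) * h ?a 1"
    by (rule row[OF _ gen_op_12 gen_op_12]) simp
  then have "h ?b 0 = h ?a 1" using e_nz by simp
  moreover have "(q ^ d - kap 0) * inverse (1 - t * inverse q * inverse (kap 0)) * h ?b 0
      = (q ^ d - kap 0) * inverse (1 - t' * inverse q * inverse (kap 0)) * h ?a 1"
    by (rule row[OF _ gen_op_02 gen_op_02]) simp
  ultimately have "inverse (1 - t * inverse q * inverse (kap 0)) = inverse (1 - t' * inverse q * inverse (kap 0))"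
    using e_nz nz by simp
  then show "t = t'" using q0 by (simp add: field_simps)
qed

end
section \<open>Existence and uniqueness of the evaluation parameter\<close>

lemma (in box_module) dim_1_span:
  assumes "subspace W" "dim W = 1"
  obtains w where "w \<in> W" "w \<noteq> 0" "W = span {w}"
proof -
  obtain B where B: "B \<subseteq> W" "independent B" "W \<subseteq> span B" "card B = dim W"
    by (rule basis_exists)
  then obtain w where w: "B = {w}" using assms(2) by (metis card_1_singletonE)
  have "w \<noteq> 0" using B(2) dependent_zero w by auto
  moreover have "W = span {w}"
    using B w assms(1) span_minimal[of "{w}" W] by auto
  ultimately show ?thesis using that B(1) w by auto
qed

context nonroot
begin

text \<open>All eigenspaces of $x_{23}$ are lines by the assumption on the shape, and their sum is the module.
  The diameter is positive, since otherwise every generator would act as the identity.\<close>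

lemma coordinates_exist:
  assumes ev: "evaluation_module q V" and diam: "has_diameter q V d"
  obtains \<psi> where "bij_betw \<psi> (coord_space d) (mod_space V)"
    "\<And>a b. a \<in> coord_space d \<Longrightarrow> b \<in> coord_space d \<Longrightarrow> \<psi> (a + b) = \<psi> a + \<psi> b"
    "\<And>c a. a \<in> coord_space d \<Longrightarrow> \<psi> (fun_scale c a) = mod_scale V c (\<psi> a)"
    "\<And>a. a \<in> coord_space d \<Longrightarrow>
      mod_act V (xgen q 2 3) (\<psi> a) = \<psi> (\<lambda>i. inverse (kap i) * a i)"
    "d \<ge> 1"
proof -
  have V: "boxtimes_module q V" using ev by (simp add: evaluation_module_def irreducible_module_def)
  interpret box_module q V by unfold_locales (rule V)
  obtain m where "has_shape q V (replicate m 1)" using ev by (auto simp: evaluation_module_def)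
  then obtain d' where type: "has_diameter_type q V d' 1" and m: "m = d' + 1"
    and dims: "\<And>a n. a \<in> std_gens q \<Longrightarrow> n \<le> d' \<Longrightarrow>
      dim (eigenspace V a (q powi (int d' - 2 * int n))) = replicate m 1 ! n"
    by (auto simp: has_shape_def)
  have x23: "xgen q 2 3 \<in> std_gens q"
    unfolding std_gens_def by (rule CollectI, rule exI[of _ 2], rule exI[of _ 3]) simp
  have "d' = d"
  proof -
    obtain \<epsilon> where "has_diameter_type q V d \<epsilon>" using diam by (auto simp: has_diameter_def)
    then have "\<epsilon> \<noteq> 0" and "eigenvalues V (xgen q 2 3) = {\<epsilon> * q powi (int d - 2 * int n) |n. n \<le> d}"
      using x23 by (auto simp: has_diameter_type_def)
    moreover have "eigenvalues V (xgen q 2 3) = {1 * q powi (int d' - 2 * int n) |n. n \<le> d'}"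
      using type x23 by (simp add: has_diameter_type_def)
    ultimately show ?thesis
      using card_eigenvalue_set[of \<epsilon> d] card_eigenvalue_set[of 1 d'] by simp
  qed
  have dim1: "dim (eigenspace V a (inverse (kap n))) = 1" if "a \<in> std_gens q" "n \<le> d" for a n
    using dims[of a n] that m \<open>d' = d\<close> by (simp add: powi_kap nth_replicate del: replicate_Suc)
  have diag: "span (\<Union>c. eigenspace V a c) = mod_space V" if "a \<in> std_gens q" for a
    using type that by (simp add: has_diameter_type_def diagonalizable_def)
  have eigenvalue: "\<exists>n\<le>d. c = inverse (kap n)" if "a \<in> std_gens q" "eigenspace V a c \<noteq> {0}" for a c
    using type that \<open>d' = d\<close> by (auto simp: has_diameter_type_def eigenvalues_def powi_kap)
  have d: "d \<ge> 1"
  proof (rule ccontr)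
    assume "\<not> d \<ge> 1"
    then have d0: "d = 0" by simp
    have one: "inverse (kap 0) = 1" using kap_0 d0 by simp
    have whole: "eigenspace V a 1 = mod_space V" if a: "a \<in> std_gens q" for a
    proof
      obtain p where p: "a = box_proj q p" using a by (auto simp: std_gens_def xgen_def)
      have "0 \<in> eigenspace V a 1" unfolding p by (rule subspace_0[OF subspace_eigenspace])
      moreover have "eigenspace V a c = {0} \<or> c = 1" for c
        using eigenvalue[OF a, of c] one d0 by auto
      ultimately have "eigenspace V a c \<subseteq> eigenspace V a 1" for c
        by (metis empty_subsetI insert_subset subset_refl)
      then have "(\<Union>c. eigenspace V a c) \<subseteq> eigenspace V a 1" by blast
      then show "mod_space V \<subseteq> eigenspace V a 1"
        unfolding diag[OF a, symmetric] p by (rule span_minimal[OF _ subspace_eigenspace])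
    qed (auto simp: eigenspace_def)
    have "dim (mod_space V) = 1" using dim1[OF x23, of 0] whole[OF x23] one by simp
    moreover have "mod_act V a v = v" if "a \<in> std_gens q" "v \<in> mod_space V" for a v
      using whole[OF that(1)] that(2) by (auto simp: eigenspace_def)
    ultimately have "trivial_module q V" using V by (simp add: trivial_module_def)
    then show False using ev by (simp add: evaluation_module_def)
  qed
  let ?W = "\<lambda>n. eigenspace V (xgen q 2 3) (inverse (kap n))"
  have "\<exists>w. w \<in> ?W n \<and> w \<noteq> 0 \<and> ?W n = span {w}" if "n \<le> d" for n
    using dim_1_span[OF subspace_eigenspace dim1[OF x23 that, unfolded xgen_def]]
    unfolding xgen_def by metis
  then obtain v where v: "\<And>n. n \<le> d \<Longrightarrow> v n \<in> ?W n" "\<And>n. n \<le> d \<Longrightarrow> v n \<noteq> 0"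
      "\<And>n. n \<le> d \<Longrightarrow> ?W n = span {v n}"
    by metis
  have vS: "v n \<in> mod_space V" if "n \<le> d" for n using v(1)[OF that] by (simp add: eigenspace_def)
  define \<psi> where "\<psi> a = (\<Sum>n\<le>d. mod_scale V (a n) (v n))" for a
  have add: "\<psi> (a + b) = \<psi> a + \<psi> b" for a b
    by (simp add: \<psi>_def scale_left_distrib sum.distrib)
  have scale: "\<psi> (fun_scale c a) = mod_scale V c (\<psi> a)" for c a
    by (simp add: \<psi>_def fun_scale_def scale_sum_right)
  have diff: "\<psi> (\<lambda>n. a n - b n) = \<psi> a - \<psi> b" for a b
    by (simp add: \<psi>_def scale_left_diff_distrib sum_subtractf)
  have unit: "\<psi> (unit_coord m) = v m" if "m \<le> d" for m
  proof -
    have "\<psi> (unit_coord m) = (\<Sum>n\<le>d. if n = m then v n else 0)"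
      unfolding \<psi>_def by (rule sum.cong) (auto simp: unit_coord_apply)
    then show ?thesis using that by simp
  qed
  have "inj_on \<psi> (coord_space d)"
  proof (rule inj_onI)
    fix a b assume a: "a \<in> coord_space d" and b: "b \<in> coord_space d" and "\<psi> a = \<psi> b"
    then have 0: "(\<Sum>n\<le>d. mod_scale V (a n - b n) (v n)) = 0"
      using diff[of a b] by (simp add: \<psi>_def)
    show "a = b"
    proof (rule coord_eqI[OF a b])
      fix i assume "i \<le> d"
      have "a i - b i = 0"
        by (rule eigenvectors_independent[of "{..d}" "\<lambda>n. inverse (kap n)" v "fa_var 2 3"])
          (use 0 v(1,2) \<open>i \<le> d\<close> in \<open>auto simp: inj_on_def kap_inj xgen_def\<close>)
      then show "a i = b i" by simp
    qed
  qed
  moreover have "\<psi> ` coord_space d = mod_space V"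
  proof
    show "\<psi> ` coord_space d \<subseteq> mod_space V"
      unfolding \<psi>_def by (auto intro!: subspace_sum[OF subspace_mod_space] mod_space_closed(3) vS)
    have "subspace (\<psi> ` coord_space d)"
    proof (rule subspaceI)
      have "\<psi> 0 = 0" by (simp add: \<psi>_def)
      then show "0 \<in> \<psi> ` coord_space d" using coord_space_closed(1) by (metis imageI)
      fix x assume "x \<in> \<psi> ` coord_space d"
      then obtain a where a: "a \<in> coord_space d" "x = \<psi> a" by blast
      show "x + y \<in> \<psi> ` coord_space d" if y: "y \<in> \<psi> ` coord_space d" for y
      proof -
        obtain b where b: "b \<in> coord_space d" "y = \<psi> b" using y by blast
        show ?thesis
          unfolding a(2) b(2) add[symmetric] by (rule imageI[OF coord_space_closed(2)[OF a(1) b(1)]])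
      qed
      show "mod_scale V c x \<in> \<psi> ` coord_space d" for c
        unfolding a(2) scale[symmetric] by (rule imageI[OF coord_space_closed(3)[OF a(1)]])
    qed
    moreover have "(\<Union>c. eigenspace V (xgen q 2 3) c) \<subseteq> \<psi> ` coord_space d"
    proof
      fix w assume "w \<in> (\<Union>c. eigenspace V (xgen q 2 3) c)"
      then obtain c where w: "w \<in> eigenspace V (xgen q 2 3) c" by blast
      show "w \<in> \<psi> ` coord_space d"
      proof (cases "eigenspace V (xgen q 2 3) c = {0}")
        case True
        then show ?thesis using w subspace_0[OF calculation] by simp
      next
        case False
        then obtain n where n: "n \<le> d" "c = inverse (kap n)" using eigenvalue[OF x23] by blast
        have "v n \<in> \<psi> ` coord_space d" using unit[OF n(1)] n(1) by (metis imageI unit_coord_in)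
        then have "span {v n} \<subseteq> \<psi> ` coord_space d"
          by (intro span_minimal calculation) simp
        then show ?thesis using w v(3)[OF n(1)] n(2) by blast
      qed
    qed
    ultimately show "mod_space V \<subseteq> \<psi> ` coord_space d"
      unfolding diag[OF x23, symmetric] by (intro span_minimal)
  qed
  ultimately have "bij_betw \<psi> (coord_space d) (mod_space V)" by (simp add: bij_betw_def)
  moreover have "mod_act V (xgen q 2 3) (\<psi> a) = \<psi> (\<lambda>i. inverse (kap i) * a i)" for a
  proof -
    have "mod_act V (xgen q 2 3) (\<psi> a) = (\<Sum>n\<le>d. act (fa_var 2 3) (mod_scale V (a n) (v n)))"
      unfolding xgen_def \<psi>_def by (rule act_sum) (auto intro: mod_space_closed vS)
    also have "\<dots> = (\<Sum>n\<le>d. mod_scale V (inverse (kap n) * a n) (v n))"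
    proof (rule sum.cong)
      fix n assume n: "n \<in> {..d}"
      then have "act (fa_var 2 3) (v n) = mod_scale V (inverse (kap n)) (v n)"
        using v(1)[of n] by (simp add: eigenspace_def xgen_def)
      then show "act (fa_var 2 3) (mod_scale V (a n) (v n)) = mod_scale V (inverse (kap n) * a n) (v n)"
        using n by (simp add: act_scale vS mult.commute)
    qed simp
    finally show ?thesis by (simp add: \<psi>_def)
  qed
  ultimately show ?thesis using that[OF _ add scale _ d] by blast
qed

theorem evaluation_module_classification:
  assumes ev: "evaluation_module q V" and diam: "has_diameter q V d"
  shows "\<exists>t. admissible t \<and> isomorphic_modules q V (Vd q d t)"
proof -
  have V: "boxtimes_module q V" using ev by (simp add: evaluation_module_def irreducible_module_def)
  interpret box_module q V by unfold_locales (rule V)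
  obtain \<psi> where bij: "bij_betw \<psi> (coord_space d) (mod_space V)"
    and add: "\<And>a b. a \<in> coord_space d \<Longrightarrow> b \<in> coord_space d \<Longrightarrow> \<psi> (a + b) = \<psi> a + \<psi> b"
    and scale: "\<And>c a. a \<in> coord_space d \<Longrightarrow> \<psi> (fun_scale c a) = mod_scale V c (\<psi> a)"
    and diag: "\<And>a. a \<in> coord_space d \<Longrightarrow>
      mod_act V (xgen q 2 3) (\<psi> a) = \<psi> (\<lambda>i. inverse (kap i) * a i)"
    and d: "d \<ge> 1"
    using coordinates_exist[OF ev diam] by blast
  define \<phi> where "\<phi> = the_inv_into (coord_space d) \<psi>"
  have inj: "inj_on \<psi> (coord_space d)" and img: "\<psi> ` coord_space d = mod_space V"
    using bij by (auto simp: bij_betw_def)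
  have \<psi>_in: "\<psi> a \<in> mod_space V" if "a \<in> coord_space d" for a using img that by blast
  have \<phi>_\<psi>: "\<phi> (\<psi> a) = a" if "a \<in> coord_space d" for a
    unfolding \<phi>_def by (rule the_inv_into_f_f[OF inj that])
  have \<psi>_\<phi>: "\<psi> (\<phi> v) = v" if "v \<in> mod_space V" for v
    unfolding \<phi>_def by (rule f_the_inv_into_f[OF inj]) (simp add: img that)
  have \<phi>_in: "\<phi> v \<in> coord_space d" if "v \<in> mod_space V" for v
    unfolding \<phi>_def by (rule the_inv_into_into[OF inj _ subset_refl]) (simp add: img that)
  \<comment> \<open>The action of the generators, transported to coordinates.\<close>
  define Y where "Y i j a = \<phi> (act (fa_var i j) (\<psi> a))" for i j a
  have Y_in: "Y i j a \<in> coord_space d" if "a \<in> coord_space d" for i j a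
    unfolding Y_def by (intro \<phi>_in act_closed \<psi>_in that)
  have \<psi>_Y: "\<psi> (Y i j a) = act (fa_var i j) (\<psi> a)" if "a \<in> coord_space d" for i j a
    unfolding Y_def by (intro \<psi>_\<phi> act_closed \<psi>_in that)
  have \<psi>_eq: "a = b" if "\<psi> a = \<psi> b" "a \<in> coord_space d" "b \<in> coord_space d" for a b
    using inj that by (auto dest: inj_onD)
  interpret Y: coord_rep q d Y
  proof
    fix i j :: 4
    show "coord_linear d (Y i j)"
      unfolding coord_linear_def
    proof (intro ballI conjI allI)
      fix a :: "nat \<Rightarrow> 'f" assume a: "a \<in> coord_space d"
      show "Y i j a \<in> coord_space d" by (rule Y_in[OF a])
      show "Y i j (fun_scale c a) = fun_scale c (Y i j a)" for c
        by (rule \<psi>_eq) (simp_all only: \<psi>_Y scale a Y_in act_scale \<psi>_in coord_space_closed)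
      show "Y i j (a + b) = Y i j a + Y i j b" if "b \<in> coord_space d" for b
        by (rule \<psi>_eq) (simp_all only: \<psi>_Y add a that Y_in act_add_vec \<psi>_in coord_space_closed)
    qed
    show "Y i j (Y j i a) = a" if "j - i = 2" "a \<in> coord_space d" for a
      by (rule \<psi>_eq) (simp_all only: \<psi>_Y that Y_in act_inv \<psi>_in)
    show "weyl_on (Y i j) (Y j k)" if ijk: "(j - i, k - j) \<in> {(1, 1), (1, 2), (2, 1)}" for k
      unfolding weyl_on_def
    proof (intro ballI allI)
      fix a :: "nat \<Rightarrow> 'f" and n assume a: "a \<in> coord_space d"
      have "fun_scale q (Y i j (Y j k a)) = fun_scale (inverse q) (Y j k (Y i j a)) + fun_scale (q - inverse q) a"
      proof (rule \<psi>_eq)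
        show "\<psi> (fun_scale q (Y i j (Y j k a)))
            = \<psi> (fun_scale (inverse q) (Y j k (Y i j a)) + fun_scale (q - inverse q) a)"
          using act_weyl[OF q_diff ijk \<psi>_in[OF a]]
          by (simp only: scale add a Y_in \<psi>_Y coord_space_closed) (simp add: algebra_simps)
      qed (simp_all only: a Y_in coord_space_closed)
      from fun_cong[OF this, of n]
      show "q * Y i j (Y j k a) n - inverse q * Y j k (Y i j a) n = (q - inverse q) * a n"
        by (simp add: fun_scale_def)
    qed
    show "diag_on (Y 2 3)"
      unfolding diag_on_def
    proof (intro ballI allI impI)
      fix a :: "nat \<Rightarrow> 'f" and i assume a: "a \<in> coord_space d"
      have "Y 2 3 a = (\<lambda>i. inverse (kap i) * a i)"
      proof (rule \<psi>_eq)
        show "\<psi> (Y 2 3 a) = \<psi> (\<lambda>i. inverse (kap i) * a i)"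
          using diag[OF a] by (simp add: \<psi>_Y[OF a] xgen_def)
        show "(\<lambda>i. inverse (kap i) * a i) \<in> coord_space d"
          using a by (auto intro!: coord_spaceI dest: coord_space_beyond)
      qed (rule Y_in[OF a])
      then show "Y 2 3 a i = inverse (kap i) * a i" by simp
    qed
  qed
  obtain t c where t: "admissible t" and c: "\<And>n. c n \<noteq> 0"
    and Y: "\<And>i j a. j - i = 1 \<or> j - i = 2 \<Longrightarrow> a \<in> coord_space d \<Longrightarrow>
      Y i j (Y.rescale c a) = Y.rescale c (app (gen_op t i j) a)"
    using Y.classification[OF d] by blast
  have "isomorphic_modules q V (Vd q d t)"
  proof (rule isomorphic_VdI[OF V t, where \<psi> = "\<lambda>a. \<psi> (Y.rescale c a)"])
    have "bij_betw (Y.rescale c) (coord_space d) (coord_space d)"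
      by (rule bij_betwI[where g = "Y.rescale (\<lambda>n. inverse (c n))"])
        (auto simp: Y.rescale_inverse[OF c])
    from bij_betw_trans[OF this bij]
    show "bij_betw (\<lambda>a. \<psi> (Y.rescale c a)) (coord_space d) (mod_space V)" by (simp add: o_def)
    show "\<psi> (Y.rescale c (a + b)) = \<psi> (Y.rescale c a) + \<psi> (Y.rescale c b)"
      if "a \<in> coord_space d" "b \<in> coord_space d" for a b
      using that by (simp only: Y.rescale_simps add)
    show "\<psi> (Y.rescale c (fun_scale s a)) = mod_scale V s (\<psi> (Y.rescale c a))"
      if "a \<in> coord_space d" for s a
      using that by (simp only: Y.rescale_simps scale)
    show "mod_act V (xgen q i j) (\<psi> (Y.rescale c a)) = \<psi> (Y.rescale c (app (gen_op t i j) a))"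
      if "j - i = 1 \<or> j - i = 2" "a \<in> coord_space d" for i j a
      unfolding Y[OF that, symmetric] xgen_def
      by (rule \<psi>_Y[symmetric]) (rule Y.rescale_simps(1)[OF that(2)])
  qed
  with t show ?thesis by blast
qed

end

theorem proposition9p6:
  fixes q :: "'f::alg_closed_field"
    and V :: "('f, 'v::ab_group_add) qmod"
    and d :: nat
  assumes "q \<noteq> 0"
    and "\<forall>n::nat. n > 0 \<longrightarrow> q ^ n \<noteq> 1"
    and "evaluation_module q V"
    and "has_diameter q V d"
  shows "\<exists>!t::'f. (t \<noteq> 0 \<and> t \<notin> {q powi (int d - 2 * int n + 1) |n. n \<in> {1..d}})
    \<and> isomorphic_modules q V (Vd q d t)"
proof -
  interpret nonroot q d by unfold_locales (use assms in auto)
  have d: "d \<ge> 1" using coordinates_exist[OF assms(3,4)] by metis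
  obtain t where t: "admissible t" "isomorphic_modules q V (Vd q d t)"
    using evaluation_module_classification[OF assms(3,4)] by blast
  have "t' = t" if "admissible t'" "isomorphic_modules q V (Vd q d t')" for t'
    by (rule isomorphic_Vd_parameter[OF d that(1) t(1) isomorphic_Vd_Vd[OF that(2) t(2)]])
  with t show ?thesis unfolding admissible_iff[symmetric] by blast
qed

end
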